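(* Let $\Psi=\frac\gamma2\|\cdot\|_2^2$ with $\gamma$ as in the context, let the (BRSC) assumption in the context be satisfied, and consider the safe oracle region (a subset of $\mathcal C^{k^*}$ containing $u^{\mathrm{or}}$ and defined without knowledge of $u^{\mathrm{or}}$) given by the Euclidean ball $\mathfrak S=B\left(u^*,\sqrt{2F_{\sigma^*}(u^* )/(\gamma C_K)}\right)$. Define $$\underline\Lambda:=F(x^* )\max\left\{\frac{\tilde L}{\gamma\min\{C_K^2,1\}}\max_{i\in{\sigma^*}^c}\|a_i\|_2^2,\ \frac1{1+K-2k^*}\right\},$$ for some $\tilde L\ge L$ (with $\tilde L=L$ valid when $\operatorname{dom}G_y=\mathbb R^M$), as well as $$\bar\Lambda:=\frac\gamma2\min\{C_K^2,1\}\left(\min_{i\in\sigma^*}|x_i^*|-\sqrt{\frac{2F(x^* )}{\gamma C_K}}\right)^2.$$ Then, if $\lambda_0\in(\underline\Lambda,\bar\Lambda)$, $x^{\mathrm{or}}$ is the unique global minimizer of $J_\Psi$ (and so of $J_0$) with $\sigma(x^{\mathrm{or}})=\sigma^*$, and any other critical point $x'$ of $J_\Psi$, $x'\neq x^{\mathrm{or}}$, satisfies $\|x'-x^{\mathrm{or}}\|_0>K$.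
   Context: Setting. $\mathcal C\in\{\mathbb R,\mathbb R_{\ge0}\}$, $A=(a_{ji})\in\mathbb R^{M\times N}$ with columns $a_1,\dots,a_N$, $\mathcal Y\subset\mathbb R$, $y\in\mathcal Y^M$, $\lambda_0>0$; $\|x\|_0$ is the number of nonzero entries of $x$ and $\sigma(x)=\{i:x_i\ne0\}$. Data term. $G_y(w)=\sum_{j=1}^Mg_{y_j}(w_j)$ on $\operatorname{dom}G_y=\prod_j\operatorname{dom}g_{y_j}$, where each $g_{y_j}$ is nonnegative, proper, strictly convex, coercive, twice differentiable on $\operatorname{int}(\operatorname{dom}g_{y_j})$, with $L$-Lipschitz derivative ($L>0$). If $\operatorname{dom}G_y\ne\mathbb R^M$, moreover $\operatorname{cl}(A\mathcal C^N)\subseteq\operatorname{int}(\operatorname{dom}G_y)$ and $\sup_{w\in A\mathcal C^N}\|\nabla G_y(w)\|<\infty$, where $A\mathcal C^N=\{Ax:x\in\mathcal C^N\}$. $F(x):=G_y(Ax)$, with $\mathcal C^N\subseteq\operatorname{int}(\operatorname{dom}F)$, and $J_0(x):=F(x)+\lambda_0\|x\|_0$ on $\mathcal C^N$. The constant $\tilde L\ge L$ comes from the bound $\|\nabla G_y(w)\|\le\sqrt{2\tilde LG_y(w)}$ for all $w\in A\mathcal C^N$; such a constant exists under these assumptions. Generating function. $\Psi(x)=\frac\gamma2\|x\|_2^2$ with $\gamma>0$ and $\gamma>\max_{i}\sum_{j=1}^Ma_{ji}^2\sup_{w\in\mathcal C}g_{y_j}''(w)$. Put $\alpha=\sqrt{2\lambda_0/\gamma}$.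 Relaxation. $J_\Psi(x):=G_y(Ax)+\sum_i\beta(x_i)$ on $\mathcal C^N$, with $\beta(t)=-\frac\gamma2t^2+\gamma\alpha|t|$ if $|t|\le\alpha$ and $\beta(t)=\lambda_0$ if $|t|>\alpha$. Both $J_0$ and $J_\Psi$ are minimized over $\mathcal C^N$. Standing assumption (CC), which the choice of $\gamma$ is meant to guarantee: for every $x\in\mathcal C^N$ and $i$, $t\mapsto J_\Psi(x_1,\dots,x_{i-1},t,x_{i+1},\dots,x_N)$ is strictly concave on $(-\alpha,0)$ and on $(0,\alpha)$ (only on $(0,\alpha)$ when $\mathcal C=\mathbb R_{\ge0}$). Known fact: under (CC), $J_\Psi$ and $J_0$ have the same global minimizers, and local minimizers of $J_\Psi$ are local minimizers of $J_0$. Critical points. With $h(t)=\beta(t)+\frac\gamma2t^2$ (convex), $x\in\mathcal C^N$ is a critical point of $J_\Psi$ iff $z=\nabla\Psi(x)-A^T\nabla G_y(Ax)$ satisfies $z_i\in\partial h(x_i)$ for all $i$, where the subdifferential $\partial h$ is given as follows. If $\mathcal C=\mathbb R$: $\partial h(t)=\{\operatorname{sign}(t)\gamma\alpha\}$ for $0<|t|\le\alpha$, $\partial h(0)=[-\gamma\alpha,\gamma\alpha]$, $\partial h(t)=\{\gamma t\}$ otherwise. If $\mathcal C=\mathbb R_{\ge0}$: $\partial h(t)=\{\gamma\alpha\}$ for $0\le t\le\alpha$, $\partial h(t)=\{\gamma t\}$ otherwise. Oracle. $x^*\in\mathcal C^N$ is the ground truth, $\sigma^*=\sigma(x^* )$,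 $k^*=\#\sigma^*$, ${\sigma^*}^c$ is the complement of $\sigma^*$, $u^*=x^*_{\sigma^*}\in\mathcal C^{k^*}$ is the restriction of $x^*$ to its support; the column submatrix $A_{\sigma^*}$ is assumed to have full rank. $F_{\sigma^*}(u):=G_y(A_{\sigma^*}u)$ (so $F_{\sigma^*}(u^* )=F(x^* )$), $u^{\mathrm{or}}=\arg\min_{u\in\mathcal C^{k^*}}F_{\sigma^*}(u)$ (unique), and the oracle solution $x^{\mathrm{or}}\in\mathcal C^N$ is $u^{\mathrm{or}}$ padded with zeros outside $\sigma^*$. (BRSC) assumption: $2k^*\le K\le N$; $\mathcal X\subseteq\mathcal C^N$ is compact, contains $x^{\mathrm{or}}$ and $x^*$, and its construction does not depend on $x^{\mathrm{or}}$; and $C_K>0$ is a constant such that $\langle\nabla F(x)-\nabla F(x'),x-x'\rangle\ge C_K\gamma\|x-x'\|_2^2$ for all $x\in\mathcal X$, $x'\in\mathcal C^N$ with $x'\ne x$ and $\|x-x'\|_0\le K$ (this is (BRSC) of $F$ with respect to $\Psi$). *)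

theory Defs
  imports "HOL-Analysis.Analysis"
begin

text \<open>
  Extended-real-valued functions are represented by an effective domain together with a
  real-valued function whose values outside the domain are irrelevant (they stand for
  \<open>+\<infinity>\<close>).  Vectors of \<open>\<C>\<^sup>N\<close> have type \<open>real^'n\<close> and coordinates in a set \<open>C\<close>.
  Vectors indexed by a support \<open>S\<close> of variable size are elements of \<open>S \<rightarrow>\<^sub>E C\<close>,
  with Euclidean norm \<open>\<lambda>u. L2_set u S\<close>.
\<close>

definition strictly_convex_on :: "real set \<Rightarrow> (real \<Rightarrow> real) \<Rightarrow> bool" where
  "strictly_convex_on S f \<longleftrightarrow> convex S \<and>
     (\<forall>x\<in>S. \<forall>y\<in>S. \<forall>t. x \<noteq> y \<and> 0 < t \<and> t < 1 \<longrightarrow>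
        f ((1 - t) * x + t * y) < (1 - t) * f x + t * f y)"

definition strictly_concave_on :: "real set \<Rightarrow> (real \<Rightarrow> real) \<Rightarrow> bool" where
  "strictly_concave_on S f \<longleftrightarrow> strictly_convex_on S (\<lambda>x. - f x)"

definition grad :: "('a::real_inner \<Rightarrow> real) \<Rightarrow> 'a \<Rightarrow> 'a" where
  "grad f x = (THE d. GDERIV f x :> d)"

definition supp :: "real^'n \<Rightarrow> 'n set" where
  "supp x = {i. x $ i \<noteq> 0}"

definition l0 :: "real^'n \<Rightarrow> nat" where
  "l0 x = card (supp x)"

definition vecs :: "real set \<Rightarrow> (real^'n) set" where
  "vecs C = {x. \<forall>i. x $ i \<in> C}"

definition upd :: "real^'n \<Rightarrow> 'n \<Rightarrow> real \<Rightarrow> real^'n" where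
  "upd x i t = (\<chi> k. if k = i then t else x $ k)"

definition global_minimizers :: "('a \<Rightarrow> real) \<Rightarrow> 'a set \<Rightarrow> 'a set" where
  "global_minimizers f S = {x. is_arg_min f (\<lambda>z. z \<in> S) x}"


text \<open>
  A scalar data term \<open>f\<close> with effective domain \<open>D\<close>.  Coercivity refers to the extension by
  \<open>+\<infinity>\<close>, hence the limit is taken inside \<open>D\<close> (and is no condition when \<open>D\<close> is bounded).
\<close>

definition scalar_data_term :: "real \<Rightarrow> real set \<Rightarrow> (real \<Rightarrow> real) \<Rightarrow> bool" where
  "scalar_data_term L D f \<longleftrightarrow>
     D \<noteq> {} \<and> (\<forall>w\<in>D. 0 \<le> f w) \<and>
     strictly_convex_on D f \<and>
     filterlim f at_top (inf at_infinity (principal D)) \<and>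
     (\<forall>w\<in>interior D. f differentiable (at w) \<and> deriv f differentiable (at w)) \<and>
     L-lipschitz_on (interior D) (deriv f)"

text \<open>\<open>g v\<close> is the scalar data term for the datum \<open>v\<close>, and \<open>D v\<close> its effective domain.\<close>

definition domG :: "(real \<Rightarrow> real set) \<Rightarrow> real^'m \<Rightarrow> (real^'m) set" where
  "domG D y = {w. \<forall>j. w $ j \<in> D (y $ j)}"

definition G :: "(real \<Rightarrow> real \<Rightarrow> real) \<Rightarrow> real^'m \<Rightarrow> real^'m \<Rightarrow> real" where
  "G g y w = (\<Sum>j\<in>UNIV. g (y $ j) (w $ j))"

definition domF :: "(real \<Rightarrow> real set) \<Rightarrow> real^'m \<Rightarrow> real^'n^'m \<Rightarrow> (real^'n) set" where
  "domF D y A = {x. A *v x \<in> domG D y}"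

definition F :: "(real \<Rightarrow> real \<Rightarrow> real) \<Rightarrow> real^'m \<Rightarrow> real^'n^'m \<Rightarrow> real^'n \<Rightarrow> real" where
  "F g y A x = G g y (A *v x)"

definition gradient_bound ::
    "(real \<Rightarrow> real \<Rightarrow> real) \<Rightarrow> real^'m \<Rightarrow> real^'n^'m \<Rightarrow> real set \<Rightarrow> real \<Rightarrow> bool" where
  "gradient_bound g y A C Lt \<longleftrightarrow>
     (\<forall>w \<in> (*v) A ` vecs C. norm (grad (G g y) w) \<le> sqrt (2 * Lt * G g y w))"

definition Psi :: "real \<Rightarrow> real^'n \<Rightarrow> real" where
  "Psi \<gamma> x = \<gamma> / 2 * (norm x)\<^sup>2"

text \<open>
  The lower bound on \<open>\<gamma>\<close>.  The supremum of \<open>g''\<close> over \<open>C\<close> only involves points at which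
  \<open>g''\<close> is defined.
\<close>

definition curvature_bound ::
    "(real \<Rightarrow> real set) \<Rightarrow> (real \<Rightarrow> real \<Rightarrow> real) \<Rightarrow> real^'m \<Rightarrow> real^'n^'m \<Rightarrow> real set \<Rightarrow> real" where
  "curvature_bound D g y A C =
     (MAX i\<in>(UNIV :: 'n set). \<Sum>j\<in>UNIV.
        (A $ j $ i)\<^sup>2 * (SUP w\<in>C \<inter> interior (D (y $ j)). deriv (deriv (g (y $ j))) w))"

definition alpha :: "real \<Rightarrow> real \<Rightarrow> real" where
  "alpha \<gamma> lam0 = sqrt (2 * lam0 / \<gamma>)"

definition beta :: "real \<Rightarrow> real \<Rightarrow> real \<Rightarrow> real" where
  "beta \<gamma> lam0 t =
     (if \<bar>t\<bar> \<le> alpha \<gamma> lam0 then - (\<gamma> / 2) * t\<^sup>2 + \<gamma> * alpha \<gamma> lam0 * \<bar>t\<bar> else lam0)"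

definition J0 ::
    "(real \<Rightarrow> real \<Rightarrow> real) \<Rightarrow> real^'m \<Rightarrow> real^'n^'m \<Rightarrow> real \<Rightarrow> real^'n \<Rightarrow> real" where
  "J0 g y A lam0 x = F g y A x + lam0 * real (l0 x)"

definition JPsi ::
    "(real \<Rightarrow> real \<Rightarrow> real) \<Rightarrow> real^'m \<Rightarrow> real^'n^'m \<Rightarrow> real \<Rightarrow> real \<Rightarrow> real^'n \<Rightarrow> real" where
  "JPsi g y A \<gamma> lam0 x = G g y (A *v x) + (\<Sum>i\<in>UNIV. beta \<gamma> lam0 (x $ i))"

text \<open>Coordinatewise strict concavity of the relaxation on \<open>(-\<alpha>,0)\<close> and \<open>(0,\<alpha>)\<close>.\<close>

definition CC ::
    "(real \<Rightarrow> real \<Rightarrow> real) \<Rightarrow> real^'m \<Rightarrow> real^'n^'m \<Rightarrow> real set \<Rightarrow> real \<Rightarrow> real \<Rightarrow> bool" where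
  "CC g y A C \<gamma> lam0 \<longleftrightarrow>
     (\<forall>x\<in>vecs C. \<forall>i.
        strictly_concave_on {0<..<alpha \<gamma> lam0} (\<lambda>t. JPsi g y A \<gamma> lam0 (upd x i t)) \<and>
        (C = UNIV \<longrightarrow>
          strictly_concave_on {- alpha \<gamma> lam0<..<0} (\<lambda>t. JPsi g y A \<gamma> lam0 (upd x i t))))"

text \<open>
  The subdifferential of \<open>h(t) = \<beta>(t) + \<gamma>/2 t\<^sup>2\<close>, by its closed form.  For
  \<open>C = {0..}\<close> the value at \<open>0\<close> is \<open>{\<gamma>\<alpha>}\<close>: the normal cone of the half line at
  \<open>0\<close> is not included.
\<close>

definition subdiff_h :: "real set \<Rightarrow> real \<Rightarrow> real \<Rightarrow> real \<Rightarrow> real set" where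
  "subdiff_h C \<gamma> lam0 t =
     (if C = UNIV then
        (if t = 0 then {- \<gamma> * alpha \<gamma> lam0 .. \<gamma> * alpha \<gamma> lam0}
         else if \<bar>t\<bar> \<le> alpha \<gamma> lam0 then {sgn t * \<gamma> * alpha \<gamma> lam0}
         else {\<gamma> * t})
      else
        (if 0 \<le> t \<and> t \<le> alpha \<gamma> lam0 then {\<gamma> * alpha \<gamma> lam0} else {\<gamma> * t}))"

definition critical_point ::
    "(real \<Rightarrow> real \<Rightarrow> real) \<Rightarrow> real^'m \<Rightarrow> real^'n^'m \<Rightarrow> real set \<Rightarrow> real \<Rightarrow> real \<Rightarrow> real^'n \<Rightarrow> bool" where
  "critical_point g y A C \<gamma> lam0 x \<longleftrightarrow> x \<in> vecs C \<and>
     (\<forall>i. (grad (Psi \<gamma>) x - transpose A *v grad (G g y) (A *v x)) $ i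
            \<in> subdiff_h C \<gamma> lam0 (x $ i))"

definition Fsub ::
    "(real \<Rightarrow> real \<Rightarrow> real) \<Rightarrow> real^'m \<Rightarrow> real^'n^'m \<Rightarrow> 'n set \<Rightarrow> ('n \<Rightarrow> real) \<Rightarrow> real" where
  "Fsub g y A S u = G g y (\<Sum>i\<in>S. u i *\<^sub>R column i A)"

definition oracle_coeffs ::
    "(real \<Rightarrow> real \<Rightarrow> real) \<Rightarrow> real^'m \<Rightarrow> real^'n^'m \<Rightarrow> real set \<Rightarrow> 'n set \<Rightarrow> 'n \<Rightarrow> real" where
  "oracle_coeffs g y A C S = arg_min_on (Fsub g y A S) (S \<rightarrow>\<^sub>E C)"

definition zero_pad :: "'n set \<Rightarrow> ('n \<Rightarrow> real) \<Rightarrow> real^'n" where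
  "zero_pad S u = (\<chi> i. if i \<in> S then u i else 0)"

definition oracle_solution ::
    "(real \<Rightarrow> real \<Rightarrow> real) \<Rightarrow> real^'m \<Rightarrow> real^'n^'m \<Rightarrow> real set \<Rightarrow> 'n set \<Rightarrow> real^'n" where
  "oracle_solution g y A C S = zero_pad S (oracle_coeffs g y A C S)"

definition BRSC ::
    "(real^'n \<Rightarrow> real) \<Rightarrow> real set \<Rightarrow> (real^'n) set \<Rightarrow> nat \<Rightarrow> real \<Rightarrow> real \<Rightarrow> bool" where
  "BRSC f C X K CK \<gamma> \<longleftrightarrow>
     (\<forall>x\<in>X. \<forall>x'\<in>vecs C. x' \<noteq> x \<and> l0 (x - x') \<le> K \<longrightarrow>
        (grad f x - grad f x') \<bullet> (x - x') \<ge> CK * \<gamma> * (norm (x - x'))\<^sup>2)"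

text \<open>The closed ball around \<open>u\<close>, intersected with the feasible set.\<close>

definition feasible_ball :: "real set \<Rightarrow> 'n set \<Rightarrow> ('n \<Rightarrow> real) \<Rightarrow> real \<Rightarrow> ('n \<Rightarrow> real) set" where
  "feasible_ball C S u r = {v \<in> S \<rightarrow>\<^sub>E C. L2_set (\<lambda>i. v i - u i) S \<le> r}"

definition Lambda_low ::
    "(real \<Rightarrow> real \<Rightarrow> real) \<Rightarrow> real^'m \<Rightarrow> real^'n^'m \<Rightarrow> real \<Rightarrow> real \<Rightarrow> nat \<Rightarrow> real \<Rightarrow> real^'n \<Rightarrow> real" where
  "Lambda_low g y A \<gamma> CK K Lt xs =
     F g y A xs *
       max (Lt / (\<gamma> * min (CK\<^sup>2) 1) * (MAX i\<in>- supp xs. (norm (column i A))\<^sup>2))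
           (1 / (1 + real K - 2 * real (l0 xs)))"

text \<open>The minimum over an empty support is read as \<open>+\<infinity>\<close>.\<close>

definition Lambda_up ::
    "(real \<Rightarrow> real \<Rightarrow> real) \<Rightarrow> real^'m \<Rightarrow> real^'n^'m \<Rightarrow> real \<Rightarrow> real \<Rightarrow> real^'n \<Rightarrow> ereal" where
  "Lambda_up g y A \<gamma> CK xs =
     (if supp xs = {} then \<infinity>
      else ereal (\<gamma> / 2 * min (CK\<^sup>2) 1 *
        ((MIN i\<in>supp xs. \<bar>xs $ i\<bar>) - sqrt (2 * F g y A xs / (\<gamma> * CK)))\<^sup>2))"

end

theory Submission
  imports Defs
begin

text \<open>
  Integrating (BRSC) along segments gives the quadratic growth
  \<open>F(x') \<ge> F(x) + \<langle>\<nabla>F(x), x' - x\<rangle> + \<gamma> C\<^sub>K/2 \<parallel>x' - x\<parallel>\<^sup>2\<close> for \<open>x \<in> \<X>\<close> and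
  \<open>\<parallel>x' - x\<parallel>\<^sub>0 \<le> K\<close>.  Based at \<open>x*\<close> it makes \<open>F\<close> coercive on vectors supported in \<open>\<sigma>*\<close>, so the
  oracle exists; based at \<open>x\<^sup>o\<^sup>r\<close> it places the oracle in the ball around \<open>u*\<close>.  The bounds on
  \<open>\<lambda>\<^sub>0\<close> then say, with \<open>c = min {C\<^sub>K, 1}\<close>, that \<open>\<bar>\<nabla>F(x\<^sup>o\<^sup>r)\<^sub>i\<bar> < \<gamma> \<alpha> c\<close> off the support and
  \<open>\<bar>x\<^sup>o\<^sup>r\<^sub>i\<bar> > \<alpha> / c\<close> on it, and \<open>F(x*) < \<lambda>\<^sub>0 (1 + K - 2 k*)\<close>.

  With these margins, the monotonicity of \<open>\<nabla>F\<close> is incompatible, coordinate by coordinate, with a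
  second critical point at \<open>\<ell>\<^sub>0\<close>-distance at most \<open>K\<close>, and growth likewise gives
  \<open>J\<^sub>\<Psi>(x\<^sup>o\<^sup>r) < J\<^sub>\<Psi>(x) \<le> J\<^sub>0(x)\<close> for such \<open>x\<close>.  A vector farther away has more than \<open>K - k*\<close>
  nonzero entries, so its \<open>J\<^sub>0\<close> is too large.  Finally, by concavity, moving each coordinate with
  \<open>0 < \<bar>x\<^sub>i\<bar> < \<alpha>\<close> to an end point decreases \<open>J\<^sub>\<Psi>\<close> until it agrees with \<open>J\<^sub>0\<close>.
\<close>

section \<open>Calculus and convexity\<close>

lemma grad_eq:
  assumes "GDERIV f x :> d"
  shows "grad f x = d"
proof -
  have "d' = d" if "GDERIV f x :> d'" for d'
  proof -
    have "(\<lambda>h. h \<bullet> d') = (\<lambda>h. h \<bullet> d)"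
      using assms that has_derivative_unique unfolding gderiv_def by blast
    then show ?thesis by (metis vector_eq_ldot)
  qed
  then show ?thesis unfolding grad_def using assms by blast
qed

text \<open>Near \<open>w\<close> the function stays below the quadratic model with curvature
  \<open>L\<close>, whose minimum \<open>f w - (f' w)^2 / (2 * L)\<close> is reached one gradient
  step away. Nonnegativity of \<open>f\<close> there gives the bound. The assumption on
  \<open>e * L\<close> keeps that step inside the neighbourhood covered by the hypotheses.\<close>

lemma deriv_square_le:
  fixes f f' :: "real \<Rightarrow> real"
  assumes der: "\<And>s. \<bar>s - w\<bar> < e \<Longrightarrow> (f has_real_derivative f' s) (at s)"
    and lip: "\<And>s. \<bar>s - w\<bar> < e \<Longrightarrow> \<bar>f' s - f' w\<bar> \<le> L * \<bar>s - w\<bar>"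
    and nonneg: "\<And>s. \<bar>s - w\<bar> < e \<Longrightarrow> 0 \<le> f s"
    and L: "L > 0" and step: "\<bar>f' w\<bar> < e * L"
  shows "(f' w)\<^sup>2 \<le> 2 * L * f w"
proof -
  define d where "d = - f' w / L"
  have de: "\<bar>d\<bar> < e" using step L by (simp add: d_def field_simps)
  have near: "\<bar>(w + t * d) - w\<bar> < e" if "0 \<le> t" "t \<le> 1" for t
  proof -
    have "\<bar>t * d\<bar> \<le> 1 * \<bar>d\<bar>" unfolding abs_mult using that by (intro mult_right_mono) auto
    then show ?thesis using de by simp
  qed
  \<comment> \<open>Up to a constant, the excess of \<open>f\<close> over its quadratic model along
    the step.\<close>
  define \<phi> where "\<phi> t = f (w + t * d) - t * (f' w * d) - L / 2 * t\<^sup>2 * d\<^sup>2" for t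
  have "\<phi> 1 \<le> \<phi> 0"
  proof (rule DERIV_nonpos_imp_nonincreasing[where f = \<phi>])
    fix t :: real assume t: "0 \<le> t" "t \<le> 1"
    have "((\<lambda>t. f (w + t * d)) has_real_derivative f' (w + t * d) * d) (at t)"
      by (rule DERIV_chain2[where f=f and g="\<lambda>t. w + t * d", OF der[OF near[OF t]]])
        (auto intro!: derivative_eq_intros)
    then have "(\<phi> has_real_derivative f' (w + t * d) * d - f' w * d - L * t * d\<^sup>2) (at t)"
      unfolding \<phi>_def by (auto intro!: derivative_eq_intros)
    moreover have "f' (w + t * d) * d - f' w * d - L * t * d\<^sup>2 \<le> 0"
    proof -
      have "(f' (w + t * d) - f' w) * d \<le> \<bar>f' (w + t * d) - f' w\<bar> * \<bar>d\<bar>"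
        by (metis abs_ge_self abs_mult)
      also have "\<dots> \<le> (L * \<bar>t * d\<bar>) * \<bar>d\<bar>"
        using lip[OF near[OF t]] by (intro mult_right_mono) auto
      also have "\<dots> = L * t * d\<^sup>2"
        using t by (simp add: abs_mult power2_eq_square)
      finally show ?thesis by (simp add: algebra_simps)
    qed
    ultimately show "\<exists>y. (\<phi> has_real_derivative y) (at t) \<and> y \<le> 0" by blast
  qed simp
  moreover have "0 \<le> f (w + d)" using nonneg[OF near[of 1]] by simp
  ultimately have "0 \<le> f w + f' w * d + L / 2 * d\<^sup>2" by (simp add: \<phi>_def)
  also have "\<dots> = f w - (f' w)\<^sup>2 / (2 * L)"
    using L by (simp add: d_def power2_eq_square field_simps)
  finally show ?thesis using L by (simp add: field_simps)
qed

lemma global_minimizers_eq_singleton: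
  assumes "a \<in> S" "\<And>x. x \<in> S \<Longrightarrow> x \<noteq> a \<Longrightarrow> f a < f x"
  shows "global_minimizers f S = {a}"
  using assms unfolding global_minimizers_def is_arg_min_linorder
  by (force simp: not_le[symmetric])

text \<open>Concavity is known on the open interval only, so the end points enter through
  continuity. If both had values at least \<open>f t\<close>, the minimum over the closed interval
  would be attained inside, against strict concavity at a midpoint.\<close>

lemma strictly_concave_interior_gt:
  fixes f :: "real \<Rightarrow> real"
  assumes conc: "strictly_concave_on {a<..<b} f" and cont: "continuous_on {a..b} f"
    and t: "a < t" "t < b"
  shows "f a < f t \<or> f b < f t"
proof (rule ccontr)
  assume not: "\<not> ?thesis"
  obtain m where m: "m \<in> {a..b}" "\<And>s. s \<in> {a..b} \<Longrightarrow> f m \<le> f s"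
    using continuous_attains_inf[OF _ _ cont] t by auto
  \<comment> \<open>If the minimum sits at an end point, the negated claim makes \<open>t\<close> a
    minimiser too.\<close>
  define p where "p = (if m = a \<or> m = b then t else m)"
  have "a < p" "p < b" using m(1) t by (auto simp: p_def)
  moreover have "f p \<le> f s" if "s \<in> {a..b}" for s
    using m(2)[OF that] not by (auto simp: p_def)
  ultimately have p: "a < p" "p < b" "\<And>s. s \<in> {a..b} \<Longrightarrow> f p \<le> f s" by blast+
  define \<delta> where "\<delta> = min (p - a) (b - p) / 2"
  have d: "0 < \<delta>" "a < p - \<delta>" "p + \<delta> < b"
    using p(1,2) by (auto simp: \<delta>_def min_def field_simps)
  have "- f ((1 - 1/2) * (p - \<delta>) + 1/2 * (p + \<delta>)) < (1 - 1/2) * - f (p - \<delta>) + 1/2 * - f (p + \<delta>)"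
    using conc[unfolded strictly_concave_on_def strictly_convex_on_def, THEN conjunct2,
        rule_format, of "p - \<delta>" "p + \<delta>" "1/2"] d p(1,2) by auto
  moreover have "(1 - 1/2) * (p - \<delta>) + 1/2 * (p + \<delta>) = p" by (simp add: field_simps)
  moreover have "f p \<le> f (p - \<delta>)" "f p \<le> f (p + \<delta>)" using p d by auto
  ultimately show False by simp
qed

section \<open>The relaxed penalty\<close>

text \<open>Completing the square merges the two branches, because \<open>alpha\<close> satisfies
  \<gamma> \<alpha>^2 / 2 = \<lambda>0. Continuity and the growth bounds are read off from this
  form.\<close>

lemma beta_eq:
  assumes "0 < \<gamma>" "0 < lam0"
  shows "beta \<gamma> lam0 t = lam0 - \<gamma> / 2 * (max 0 (alpha \<gamma> lam0 - \<bar>t\<bar>))\<^sup>2"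
proof -
  have lam0: "lam0 = \<gamma> / 2 * (alpha \<gamma> lam0)\<^sup>2"
    using assms by (simp add: alpha_def)
  show ?thesis
  proof (cases "\<bar>t\<bar> \<le> alpha \<gamma> lam0")
    case True
    have "- (\<gamma> / 2) * t\<^sup>2 + \<gamma> * a * \<bar>t\<bar> = \<gamma> / 2 * a\<^sup>2 - \<gamma> / 2 * (a - \<bar>t\<bar>)\<^sup>2" for a
      by (simp add: power2_diff algebra_simps)
    from this[of "alpha \<gamma> lam0"] show ?thesis
      using True lam0 by (simp add: beta_def max_def)
  qed (simp add: beta_def)
qed

lemma beta_le:
  assumes "0 < \<gamma>" "0 < lam0"
  shows "beta \<gamma> lam0 t \<le> (if t = 0 then 0 else lam0)"
  using assms by (auto simp: beta_eq) (simp add: beta_eq[symmetric] beta_def alpha_def)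

lemma beta_eq_l0:
  assumes "0 < \<gamma>" "0 < lam0" "t = 0 \<or> alpha \<gamma> lam0 \<le> \<bar>t\<bar>"
  shows "beta \<gamma> lam0 t = (if t = 0 then 0 else lam0)"
proof (cases "t = 0")
  case True
  with assms show ?thesis by (simp add: beta_def alpha_def)
next
  case False
  with assms show ?thesis by (simp add: beta_eq)
qed

text \<open>These three facts are all that the critical point argument takes from the
  subdifferential; after them the line and the half line need no separate treatment.\<close>

lemma subdiff_h_bounds:
  assumes "C = UNIV \<or> C = {0..}" "t \<in> C" "z \<in> subdiff_h C \<gamma> lam0 t" "0 < \<gamma>" "0 < lam0"
  shows "\<bar>t\<bar> \<le> alpha \<gamma> lam0 \<Longrightarrow> \<bar>z\<bar> \<le> \<gamma> * alpha \<gamma> lam0"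
    and "\<bar>t\<bar> \<le> alpha \<gamma> lam0 \<Longrightarrow> z * t = \<gamma> * alpha \<gamma> lam0 * \<bar>t\<bar>"
    and "alpha \<gamma> lam0 < \<bar>t\<bar> \<Longrightarrow> z = \<gamma> * t"
proof -
  have ne: "{0..} \<noteq> (UNIV :: real set)" by (metis UNIV_I atLeast_iff not_one_le_zero neg_0_le_iff_le)
  have a: "0 < alpha \<gamma> lam0" using assms by (simp add: alpha_def)
  have g: "0 < \<gamma> * alpha \<gamma> lam0" using a assms by simp
  show "\<bar>t\<bar> \<le> alpha \<gamma> lam0 \<Longrightarrow> \<bar>z\<bar> \<le> \<gamma> * alpha \<gamma> lam0"
    using assms a g ne by (auto simp: subdiff_h_def abs_le_iff sgn_real_def split: if_splits)
  show "\<bar>t\<bar> \<le> alpha \<gamma> lam0 \<Longrightarrow> z * t = \<gamma> * alpha \<gamma> lam0 * \<bar>t\<bar>"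
    using assms a g ne by (auto simp: subdiff_h_def sgn_real_def split: if_splits)
  show "alpha \<gamma> lam0 < \<bar>t\<bar> \<Longrightarrow> z = \<gamma> * t"
    using assms a g ne by (auto simp: subdiff_h_def split: if_splits)
qed

section \<open>One-coordinate inequalities under the two margins\<close>

lemma min_one_bounds:
  fixes c :: real
  assumes "0 < c"
  shows "0 < min c 1" "min c 1 \<le> 1" "min c 1 \<le> c" "(min c 1)\<^sup>2 \<le> c" "(min c 1)\<^sup>2 = min (c\<^sup>2) 1"
proof -
  show "(min c 1)\<^sup>2 \<le> c"
    using assms by (auto simp: min_def power2_eq_square mult_left_le)
  show "(min c 1)\<^sup>2 = min (c\<^sup>2) 1"
    using assms power_le_one[of c 2] one_le_power[of c 2]
    by (cases "c \<le> 1") (auto simp: min_def abs_square_le_1)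
qed (use assms in auto)

text \<open>Here the oracle has coordinate 0 and dual value \<open>z\<close>, the competitor
  coordinate \<open>t\<close> and dual value \<open>z'\<close>. With \<open>m = min c 1\<close>, the
  margin leaves more than \<gamma> \<alpha> (1 - m) |t| for small \<open>t\<close> and more than
  \<gamma> t^2 - \<gamma> \<alpha> m |t| for large \<open>t\<close>. Both dominate \<gamma> (1 - m)
  t^2, and 1 - c \<le> 1 - m.\<close>

lemma separation_off_support:
  fixes \<gamma> \<alpha> c t z z' :: real
  assumes "0 < \<gamma>" "0 < c" "\<bar>z\<bar> < \<gamma> * \<alpha> * min c 1" "t \<noteq> 0"
    and small: "\<bar>t\<bar> \<le> \<alpha> \<Longrightarrow> z' * t = \<gamma> * \<alpha> * \<bar>t\<bar>"
    and large: "\<alpha> < \<bar>t\<bar> \<Longrightarrow> z' = \<gamma> * t"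
  shows "\<gamma> * (1 - c) * t\<^sup>2 < (z' - z) * t"
proof -
  define m where "m = min c 1"
  have m: "0 < m" "m \<le> 1" "m \<le> c" using min_one_bounds[OF assms(2)] by (auto simp: m_def)
  have zt: "z * t < \<gamma> * \<alpha> * m * \<bar>t\<bar>"
  proof -
    have "z * t \<le> \<bar>z\<bar> * \<bar>t\<bar>" by (metis abs_ge_self abs_mult)
    also have "\<dots> < \<gamma> * \<alpha> * m * \<bar>t\<bar>" using assms by (intro mult_strict_right_mono) (auto simp: m_def)
    finally show ?thesis .
  qed
  have c: "(1 - c) \<le> 1 - m" "0 \<le> 1 - m" using m by auto
  have c': "\<gamma> * (1 - c) * t\<^sup>2 \<le> \<gamma> * (1 - m) * t\<^sup>2"
    using c assms by (intro mult_right_mono mult_left_mono) auto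
  have t2: "t\<^sup>2 = \<bar>t\<bar> * \<bar>t\<bar>" by (simp add: power2_eq_square)
  show ?thesis
  proof (cases "\<bar>t\<bar> \<le> \<alpha>")
    case True
    have "\<gamma> * (1 - m) * t\<^sup>2 \<le> \<gamma> * (1 - m) * (\<alpha> * \<bar>t\<bar>)"
      unfolding t2 using True c assms by (intro mult_left_mono mult_right_mono) auto
    then show ?thesis using c' zt small[OF True] by (simp add: algebra_simps)
  next
    case False
    have "\<gamma> * m * (\<alpha> * \<bar>t\<bar>) \<le> \<gamma> * m * t\<^sup>2"
      unfolding t2 using False m assms by (intro mult_left_mono mult_right_mono) auto
    then show ?thesis using c' zt large False by (simp add: algebra_simps power2_eq_square)
  qed
qed

text \<open>Here \<open>s\<close> is the oracle coordinate, with dual value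
  \<open>\<gamma> * s\<close> since the gradient vanishes there. For large \<open>t\<close> the
  right side is \<gamma> (t - s)^2; for small \<open>t\<close> the dual value \<open>z'\<close> is
  capped by \<gamma> \<alpha>, which the margin places below \<gamma> s m when \<open>s\<close> is
  positive.\<close>

lemma separation_on_support:
  fixes \<gamma> \<alpha> c s t z' :: real
  assumes "0 < \<gamma>" "0 < c" "\<alpha> < \<bar>s\<bar> * min c 1" "t \<noteq> s"
    and small: "\<bar>t\<bar> \<le> \<alpha> \<Longrightarrow> \<bar>z'\<bar> \<le> \<gamma> * \<alpha>" "\<bar>t\<bar> \<le> \<alpha> \<Longrightarrow> z' * t = \<gamma> * \<alpha> * \<bar>t\<bar>"
    and large: "\<alpha> < \<bar>t\<bar> \<Longrightarrow> z' = \<gamma> * t"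
  shows "\<gamma> * (1 - c) * (t - s)\<^sup>2 < (z' - \<gamma> * s) * (t - s)"
proof -
  define m where "m = min c 1"
  have m: "0 < m" "m \<le> 1" "m \<le> c" using min_one_bounds[OF assms(2)] by (auto simp: m_def)
  have c: "(1 - c) \<le> 1 - m" "0 \<le> 1 - m" using m by auto
  have "\<gamma> * (1 - c) * (t - s)\<^sup>2 \<le> \<gamma> * (1 - m) * (t - s)\<^sup>2"
    using c assms by (intro mult_right_mono mult_left_mono) auto
  also have "\<gamma> * (1 - m) * (t - s)\<^sup>2 < (z' - \<gamma> * s) * (t - s)"
  proof (cases "\<bar>t\<bar> \<le> \<alpha>")
    case False
    then have "(z' - \<gamma> * s) * (t - s) = \<gamma> * (t - s)\<^sup>2"
      using large by (simp add: power2_eq_square algebra_simps)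
    then show ?thesis using m assms by simp
  next
    case True
    \<comment> \<open>Stated for fresh variables, so that negative \<open>s\<close> follows by
      changing the signs of \<open>s\<close>, \<open>t\<close> and \<open>z'\<close>
      together.\<close>
    have main: "\<gamma> * (1 - m) * (t - s)\<^sup>2 < (z' - \<gamma> * s) * (t - s)"
      if "0 < s" "\<alpha> < s * m" "\<bar>z'\<bar> \<le> \<gamma> * \<alpha>" "z' * t = \<gamma> * \<alpha> * \<bar>t\<bar>" "\<bar>t\<bar> \<le> \<alpha>"
      for s t z' :: real
    proof -
      have sm: "s * m \<le> s" using that m by simp
      have "\<gamma> * (1 - m) * (s - t) < \<gamma> * s - z'"
      proof (cases "0 \<le> t")
        case True
        have "\<gamma> * (1 - m) * (s - t) \<le> \<gamma> * (1 - m) * s"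
          using True m assms(1) by (intro mult_left_mono) auto
        moreover have "\<gamma> * \<alpha> < \<gamma> * (s * m)" using that assms(1) by simp
        ultimately show ?thesis using that by (simp add: algebra_simps)
      next
        case False
        then have "z' = - (\<gamma> * \<alpha>)" 
            using that(4) by (metis abs_of_neg linorder_not_le minus_mult_commute mult_right_cancel order_less_irrefl)
        moreover have "\<gamma> * (1 - m) * (s - t) < \<gamma> * (s - t)"
          using that m assms(1) False by (simp add: mult_less_cancel_right)
        moreover have "\<gamma> * (s - t) \<le> \<gamma> * (s + \<alpha>)" using that assms(1) by simp
        ultimately show ?thesis by (simp add: algebra_simps)
      qed
      moreover have "0 < s - t" using that sm by linarith
      ultimately have "\<gamma> * (1 - m) * (s - t) * (s - t) < (\<gamma> * s - z') * (s - t)"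
        by (intro mult_strict_right_mono) auto
      then show ?thesis by (simp add: algebra_simps power2_eq_square)
    qed
    have "0 \<le> \<alpha>" using True by simp
    consider "0 < s" | "0 < - s" using assms(3) m \<open>0 \<le> \<alpha>\<close> by fastforce
    then show ?thesis
    proof cases
      case 1
      then show ?thesis using main[of s z' t] assms small True by (simp add: m_def)
    next
      case 2
      have "\<gamma> * (1 - m) * (- t - - s)\<^sup>2 < (- z' - \<gamma> * - s) * (- t - - s)"
        by (rule main) (use 2 assms small True in \<open>auto simp: m_def\<close>)
      then show ?thesis by (simp add: algebra_simps power2_eq_square)
    qed
  qed
  finally show ?thesis .
qed

text \<open>For use with \<open>z\<close> equal to minus a component of the gradient at the oracle.
  After replacing \<open>z * t\<close> by its strict upper bound and dividing by \<gamma> / 2, the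
  remainder is (1 - m) |t| (2 \<alpha> - |t|) + (c - m) t^2 for small \<open>t\<close> and (\<alpha>
  - m |t|)^2 + (c - m^2) t^2 for large \<open>t\<close>, with \<open>m = min c 1\<close>.\<close>

lemma beta_growth_off_support:
  assumes "0 < \<gamma>" "0 < lam0" "0 < c" "\<bar>z\<bar> < \<gamma> * alpha \<gamma> lam0 * min c 1" "t \<noteq> 0"
  shows "0 < beta \<gamma> lam0 t - z * t + c * \<gamma> / 2 * t\<^sup>2"
proof -
  define m where "m = min c 1"
  define \<alpha> where "\<alpha> = alpha \<gamma> lam0"
  have m: "0 < m" "m \<le> 1" "m \<le> c" "m\<^sup>2 \<le> c" using min_one_bounds[OF assms(3)] by (auto simp: m_def)
  have lam0: "lam0 = \<gamma> / 2 * \<alpha>\<^sup>2" using assms by (simp add: alpha_def \<alpha>_def)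
  have zt: "z * t < \<gamma> * \<alpha> * m * \<bar>t\<bar>"
  proof -
    have "z * t \<le> \<bar>z\<bar> * \<bar>t\<bar>" by (metis abs_ge_self abs_mult)
    also have "\<dots> < \<gamma> * \<alpha> * m * \<bar>t\<bar>" using assms by (intro mult_strict_right_mono) (auto simp: m_def \<alpha>_def)
    finally show ?thesis .
  qed
  have t2: "t\<^sup>2 = \<bar>t\<bar>\<^sup>2" by simp
  have "0 \<le> \<alpha>\<^sup>2 - (max 0 (\<alpha> - \<bar>t\<bar>))\<^sup>2 - 2 * \<alpha> * m * \<bar>t\<bar> + c * t\<^sup>2"
  proof (cases "\<bar>t\<bar> \<le> \<alpha>")
    case True
    have "0 \<le> (1 - m) * \<bar>t\<bar> * (2 * \<alpha> - \<bar>t\<bar>) + (c - m) * t\<^sup>2"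
      using m True by (intro add_nonneg_nonneg mult_nonneg_nonneg) auto
    also have "\<dots> = \<alpha>\<^sup>2 - (\<alpha> - \<bar>t\<bar>)\<^sup>2 - 2 * \<alpha> * m * \<bar>t\<bar> + c * t\<^sup>2"
      unfolding t2 by (simp add: power2_eq_square algebra_simps)
    finally show ?thesis using True by (simp add: max_def)
  next
    case False
    have "0 \<le> (\<alpha> - m * \<bar>t\<bar>)\<^sup>2 + (c - m\<^sup>2) * t\<^sup>2"
      using m by (intro add_nonneg_nonneg mult_nonneg_nonneg) auto
    also have "\<dots> = \<alpha>\<^sup>2 - 2 * \<alpha> * m * \<bar>t\<bar> + c * t\<^sup>2"
      unfolding t2 by (simp add: power2_eq_square algebra_simps)
    finally show ?thesis using False by (simp add: max_def)
  qed
  then have "0 \<le> \<gamma> / 2 * (\<alpha>\<^sup>2 - (max 0 (\<alpha> - \<bar>t\<bar>))\<^sup>2 - 2 * \<alpha> * m * \<bar>t\<bar> + c * t\<^sup>2)"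
    using assms by (intro mult_nonneg_nonneg) auto
  then show ?thesis
    using zt lam0 unfolding beta_eq[OF assms(1,2)] \<alpha>_def[symmetric] by (simp add: algebra_simps)
qed

text \<open>At \<open>s\<close> the penalty is saturated, so only the deficit of \<open>beta\<close>
  at \<open>t\<close> must be paid for. The margin and m \<le> 1 give \<alpha> - |t| < m (|s| - |t|)
  \<le> m |t - s|, and m^2 \<le> c.\<close>

lemma beta_growth_on_support:
  assumes "0 < \<gamma>" "0 < lam0" "0 < c" "alpha \<gamma> lam0 < \<bar>s\<bar> * min c 1" "t \<noteq> s"
  shows "0 < beta \<gamma> lam0 t - beta \<gamma> lam0 s + c * \<gamma> / 2 * (t - s)\<^sup>2"
proof -
  define m where "m = min c 1"
  define \<alpha> where "\<alpha> = alpha \<gamma> lam0"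
  have m: "0 < m" "m \<le> 1" "m \<le> c" "m\<^sup>2 \<le> c" using min_one_bounds[OF assms(3)] by (auto simp: m_def)
  have a: "\<alpha> < m * \<bar>s\<bar>" using assms by (simp add: m_def \<alpha>_def mult.commute)
  have "m * \<bar>s\<bar> \<le> 1 * \<bar>s\<bar>" using m by (intro mult_right_mono) auto
  then have bs: "beta \<gamma> lam0 s = lam0"
    using a unfolding beta_eq[OF assms(1,2)] \<alpha>_def[symmetric] by simp
  have "(max 0 (\<alpha> - \<bar>t\<bar>))\<^sup>2 < c * (t - s)\<^sup>2"
  proof (cases "\<bar>t\<bar> \<le> \<alpha>")
    case True
    have "m * \<bar>t\<bar> \<le> 1 * \<bar>t\<bar>" using m by (intro mult_right_mono) auto
    then have "\<alpha> - \<bar>t\<bar> < m * \<bar>s\<bar> - m * \<bar>t\<bar>" using a by simp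
    also have "\<dots> = m * (\<bar>s\<bar> - \<bar>t\<bar>)" by (simp add: algebra_simps)
    also have "\<dots> \<le> m * \<bar>t - s\<bar>" using m by (intro mult_left_mono) auto
    finally have "(\<alpha> - \<bar>t\<bar>)\<^sup>2 < (m * \<bar>t - s\<bar>)\<^sup>2" using True by (intro power_strict_mono) auto
    also have "\<dots> \<le> c * (t - s)\<^sup>2"
      using m by (simp add: power_mult_distrib mult_right_mono)
    finally show ?thesis using True by (simp add: max_def)
  qed (use assms in auto)
  then have "\<gamma> / 2 * (max 0 (\<alpha> - \<bar>t\<bar>))\<^sup>2 < \<gamma> / 2 * (c * (t - s)\<^sup>2)"
    using assms by simp
  then show ?thesis
    unfolding bs unfolding beta_eq[OF assms(1,2)] \<alpha>_def[symmetric] by (simp add: algebra_simps)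
qed

lemma sum_support_const: "(\<Sum>i\<in>UNIV. if x $ i = 0 then 0 else c) = c * real (l0 x)"
proof -
  have "(\<Sum>i\<in>UNIV. if x $ i = 0 then 0 else c) = (\<Sum>i\<in>supp x. c)"
    by (rule sum.mono_neutral_cong_right) (auto simp: supp_def)
  then show ?thesis by (simp add: l0_def)
qed

lemma JPsi_le_J0:
  assumes "0 < \<gamma>" "0 < lam0"
  shows "JPsi g y A \<gamma> lam0 x \<le> J0 g y A lam0 x"
  unfolding JPsi_def J0_def F_def sum_support_const[symmetric]
  using beta_le[OF assms] by (intro add_left_mono sum_mono)

lemma JPsi_eq_J0:
  assumes "0 < \<gamma>" "0 < lam0" "\<And>i. x $ i = 0 \<or> alpha \<gamma> lam0 \<le> \<bar>x $ i\<bar>"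
  shows "JPsi g y A \<gamma> lam0 x = J0 g y A lam0 x"
  unfolding JPsi_def J0_def F_def sum_support_const[symmetric]
  using beta_eq_l0[OF assms(1,2)] assms(3) by (simp cong: sum.cong)

section \<open>Data fidelity\<close>

lemma upd_same: "upd x i (x $ i) = x"
  by (simp add: upd_def vec_eq_iff)

lemma upd_nth: "upd x i t $ k = (if k = i then t else x $ k)"
  by (simp add: upd_def)

lemma domG_UNIV_iff: "domG D y = UNIV \<longleftrightarrow> (\<forall>j. D (y $ j) = UNIV)"
proof
  assume *: "domG D y = UNIV"
  have "w \<in> D (y $ j)" for j w
  proof -
    have "(\<chi> k. w) \<in> domG D y" using * by simp
    then show ?thesis by (simp add: domG_def)
  qed
  then show "\<forall>j. D (y $ j) = UNIV" by auto
qed (simp add: domG_def)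

lemma interior_domG_nth:
  assumes "w \<in> interior (domG D y)"
  shows "w $ j \<in> interior (D (y $ j))"
proof -
  obtain e where e: "e > 0" "ball w e \<subseteq> domG D y" using assms by (meson mem_interior)
  have "ball (w $ j) e \<subseteq> D (y $ j)"
  proof
    fix s assume s: "s \<in> ball (w $ j) e"
    have "w - upd w j s = (w $ j - s) *\<^sub>R axis j 1"
      by (simp add: vec_eq_iff upd_nth axis_def)
    then have "upd w j s \<in> ball w e" using s by (simp add: dist_norm)
    then have "upd w j s \<in> domG D y" using e by blast
    then show "s \<in> D (y $ j)" unfolding domG_def by (auto simp: upd_nth dest: spec[of _ j])
  qed
  then show ?thesis using e by (auto simp: mem_interior)
qed

lemma vecs_convex_comb:
  assumes "C = UNIV \<or> C = {0..}" "x \<in> vecs C" "z \<in> vecs C" "0 \<le> t" "t \<le> 1"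
  shows "x + t *\<^sub>R (z - x) \<in> vecs C"
proof -
  have "0 \<le> (1 - t) * a + t * b" if "0 \<le> a" "0 \<le> b" for a b :: real
    using that assms by simp
  then have "0 \<le> a + t * (b - a)" if "0 \<le> a" "0 \<le> b" for a b :: real
    using that by (simp add: algebra_simps)
  then show ?thesis
    using assms(1-3) by (auto simp: vecs_def)
qed

text \<open>\<open>range_interior\<close> is the form common to both domain cases: it is trivial on
  the full space and follows from the closure condition otherwise.\<close>

locale data_fidelity =
  fixes C :: "real set" and A :: "real^'n^'m" and y :: "real^'m"
    and D :: "real \<Rightarrow> real set" and g :: "real \<Rightarrow> real \<Rightarrow> real" and L :: real
  assumes C: "C = UNIV \<or> C = {0..}"
    and L: "0 < L"
    and data_term: "\<And>j. scalar_data_term L (D (y $ j)) (g (y $ j))"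
    and range_interior: "\<And>x j. x \<in> vecs C \<Longrightarrow> (A *v x) $ j \<in> interior (D (y $ j))"
begin

lemma deriv_g:
  assumes "w \<in> interior (D (y $ j))"
  shows "(g (y $ j) has_real_derivative deriv (g (y $ j)) w) (at w)"
  using data_term[of j] assms
  by (auto simp: scalar_data_term_def real_differentiable_def DERIV_deriv_iff_real_differentiable)

lemma g_nonneg: "w \<in> interior (D (y $ j)) \<Longrightarrow> 0 \<le> g (y $ j) w"
  using data_term[of j] interior_subset by (auto simp: scalar_data_term_def)

lemma deriv_g_lipschitz:
  assumes "v \<in> interior (D (y $ j))" "w \<in> interior (D (y $ j))"
  shows "\<bar>deriv (g (y $ j)) v - deriv (g (y $ j)) w\<bar> \<le> L * \<bar>v - w\<bar>"
  using data_term[of j] assms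
  by (auto simp: scalar_data_term_def dist_real_def dest: lipschitz_onD)

lemma G_gderiv:
  assumes "\<And>j. w $ j \<in> interior (D (y $ j))"
  shows "GDERIV (G g y) w :> (\<chi> j. deriv (g (y $ j)) (w $ j))"
proof -
  have "((\<lambda>w. g (y $ j) (w $ j)) has_derivative (\<lambda>h. deriv (g (y $ j)) (w $ j) * h $ j)) (at w)" for j
  proof -
    have "(g (y $ j) has_derivative (\<lambda>h. deriv (g (y $ j)) (w $ j) * h)) (at (w $ j))"
      using deriv_g[OF assms] by (simp add: has_field_derivative_def)
    from has_derivative_compose[OF bounded_linear_imp_has_derivative[OF bounded_linear_vec_nth] this]
    show ?thesis .
  qed
  then have "((\<lambda>w. \<Sum>j\<in>UNIV. g (y $ j) (w $ j)) has_derivative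
      (\<lambda>h. \<Sum>j\<in>UNIV. deriv (g (y $ j)) (w $ j) * h $ j)) (at w)"
    by (intro has_derivative_sum) auto
  then show ?thesis
    by (simp add: gderiv_def G_def[abs_def] inner_vec_def mult.commute)
qed

lemma grad_G_nth:
  assumes "x \<in> vecs C"
  shows "grad (G g y) (A *v x) $ j = deriv (g (y $ j)) ((A *v x) $ j)"
  using grad_eq[OF G_gderiv[of "A *v x"]] range_interior[OF assms] by simp

lemma F_gderiv:
  assumes "x \<in> vecs C"
  shows "GDERIV (F g y A) x :> transpose A *v grad (G g y) (A *v x)"
proof -
  let ?d = "grad (G g y) (A *v x)"
  have "(G g y has_derivative (\<lambda>h. h \<bullet> ?d)) (at (A *v x))"
    using G_gderiv[of "A *v x"] grad_eq[OF G_gderiv[of "A *v x"]] range_interior[OF assms]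
    by (simp add: gderiv_def)
  from has_derivative_compose[OF bounded_linear_imp_has_derivative[OF matrix_vector_mul_bounded_linear] this]
  have "((\<lambda>x. G g y (A *v x)) has_derivative (\<lambda>h. (A *v h) \<bullet> ?d)) (at x)" .
  moreover have "(A *v h) \<bullet> ?d = h \<bullet> (transpose A *v ?d)" for h
    by (metis dot_lmul_matrix inner_commute transpose_matrix_vector)
  ultimately show ?thesis
    by (simp add: gderiv_def F_def[abs_def])
qed

lemma grad_F:
  assumes "x \<in> vecs C"
  shows "grad (F g y A) x = transpose A *v grad (G g y) (A *v x)"
  using grad_eq[OF F_gderiv[OF assms]] .

lemma F_gderiv':
  assumes "x \<in> vecs C"
  shows "GDERIV (F g y A) x :> grad (F g y A) x"
  using F_gderiv[OF assms] grad_F[OF assms] by simp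

lemma F_continuous_on: "continuous_on (vecs C) (F g y A)"
  using F_gderiv' unfolding gderiv_def
  by (metis continuous_at_imp_continuous_on has_derivative_continuous)

lemma grad_F_nth:
  assumes "x \<in> vecs C"
  shows "grad (F g y A) x $ i = column i A \<bullet> grad (G g y) (A *v x)"
  unfolding grad_F[OF assms] matrix_vector_mul_component
  by (simp add: row_transpose[symmetric] row_def)

lemma F_nonneg: "x \<in> vecs C \<Longrightarrow> 0 \<le> F g y A x"
  unfolding F_def G_def using g_nonneg range_interior by (intro sum_nonneg) auto

text \<open>\<open>deriv_square_le\<close> is applied in each coordinate and summed. One radius
  \<open>e\<close> serves all coordinates, since every component of the gradient is bounded by its
  norm.\<close>

lemma norm_grad_G_le:
  assumes x: "x \<in> vecs C" and Lt: "L \<le> Lt"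
    and near: "\<And>j s. \<bar>s - (A *v x) $ j\<bar> < e \<Longrightarrow> s \<in> interior (D (y $ j))"
    and bound: "norm (grad (G g y) (A *v x)) < e * Lt"
  shows "norm (grad (G g y) (A *v x)) \<le> sqrt (2 * Lt * G g y (A *v x))"
proof -
  let ?w = "A *v x" and ?d = "grad (G g y) (A *v x)"
  have "(?d $ j)\<^sup>2 \<le> 2 * Lt * g (y $ j) (?w $ j)" for j
  proof -
    have "(deriv (g (y $ j)) (?w $ j))\<^sup>2 \<le> 2 * Lt * g (y $ j) (?w $ j)"
    proof (rule deriv_square_le[where e = e and f = "g (y $ j)" and f' = "deriv (g (y $ j))"])
      fix s assume s: "\<bar>s - ?w $ j\<bar> < e"
      note s' = near[OF s]
      show "(g (y $ j) has_real_derivative deriv (g (y $ j)) s) (at s)"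
        using deriv_g[OF s'] .
      show "0 \<le> g (y $ j) s" using g_nonneg[OF s'] .
      have "\<bar>deriv (g (y $ j)) s - deriv (g (y $ j)) (?w $ j)\<bar> \<le> L * \<bar>s - ?w $ j\<bar>"
        using deriv_g_lipschitz[OF s' range_interior[OF x]] .
      also have "\<dots> \<le> Lt * \<bar>s - ?w $ j\<bar>" using Lt by (intro mult_right_mono) auto
      finally show "\<bar>deriv (g (y $ j)) s - deriv (g (y $ j)) (?w $ j)\<bar> \<le> Lt * \<bar>s - ?w $ j\<bar>" .
    next
      show "0 < Lt" using L Lt by simp
      show "\<bar>deriv (g (y $ j)) (?w $ j)\<bar> < e * Lt"
        using bound component_le_norm_cart[of ?d j] grad_G_nth[OF x, of j] by simp
    qed
    then show ?thesis using grad_G_nth[OF x, of j] by simp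
  qed
  then have "(\<Sum>j\<in>UNIV. (?d $ j)\<^sup>2) \<le> (\<Sum>j\<in>UNIV. 2 * Lt * g (y $ j) (?w $ j))"
    by (rule sum_mono)
  then have "(norm ?d)\<^sup>2 \<le> 2 * Lt * G g y ?w"
    unfolding power2_norm_eq_inner inner_vec_def G_def by (simp add: power2_eq_square sum_distrib_left)
  then show "norm ?d \<le> sqrt (2 * Lt * G g y ?w)"
    by (rule real_le_rsqrt)
qed


lemma gradient_bound_unconstrained:
  assumes "domG D y = UNIV"
  shows "gradient_bound g y A C L"
proof -
  have univ: "D (y $ j) = UNIV" for j using assms by (simp add: domG_UNIV_iff)
  show ?thesis unfolding gradient_bound_def
  proof safe
    fix x :: "real^'n" assume x: "x \<in> vecs C"
    show "norm (grad (G g y) (A *v x)) \<le> sqrt (2 * L * G g y (A *v x))"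
      \<comment> \<open>On a full domain every radius is admissible; this one makes
        \<open>e * L\<close> exceed the norm of the gradient by \<open>L\<close>.\<close>
      by (rule norm_grad_G_le[OF x, where e = "norm (grad (G g y) (A *v x)) / L + 1"])
        (use L univ in \<open>auto simp: field_simps\<close>)
  qed
qed

text \<open>The coordinate projections of \<open>A\<C>\<^sup>N\<close> are cones, so by convexity a neighbourhood of
  \<open>0\<close> in \<open>D (y $ j)\<close> yields one of half its size around every point of the projection.\<close>

lemma uniform_interior:
  "\<exists>e>0. \<forall>x\<in>vecs C. \<forall>j s. \<bar>s - (A *v x) $ j\<bar> < e \<longrightarrow> s \<in> interior (D (y $ j))"
proof -
  have "\<exists>e>0. \<forall>x\<in>vecs C. \<forall>s. \<bar>s - (A *v x) $ j\<bar> < e \<longrightarrow> s \<in> interior (D (y $ j))" for j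
  proof -
    have "0 \<in> vecs C" using C by (auto simp: vecs_def)
    from range_interior[OF this, of j] have "0 \<in> interior (D (y $ j))" by simp
    then obtain e where e: "e > 0" "ball 0 e \<subseteq> D (y $ j)" by (meson mem_interior)
    have conv: "convex (D (y $ j))"
      using data_term[of j] by (simp add: scalar_data_term_def strictly_convex_on_def)
    have "s \<in> interior (D (y $ j))" if x: "x \<in> vecs C" and s: "\<bar>s - (A *v x) $ j\<bar> < e / 2" for x s
    proof -
      have "ball ((A *v x) $ j) (e / 2) \<subseteq> D (y $ j)"
      proof
        fix v assume v: "v \<in> ball ((A *v x) $ j) (e / 2)"
        have "2 *\<^sub>R x \<in> vecs C" using x C by (auto simp: vecs_def)
        from range_interior[OF this, of j] have "2 * (A *v x) $ j \<in> D (y $ j)"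
          using interior_subset by (auto simp: matrix_vector_mult_scaleR)
        moreover have "2 * (v - (A *v x) $ j) \<in> ball 0 e"
          using v abs_mult[of 2 "v - (A *v x) $ j"] by (simp add: dist_real_def abs_minus_commute)
        then have "2 * (v - (A *v x) $ j) \<in> D (y $ j)"
          using e(2) by blast
        ultimately have "(1/2) *\<^sub>R (2 * (A *v x) $ j) + (1/2) *\<^sub>R (2 * (v - (A *v x) $ j)) \<in> D (y $ j)"
          by (intro convexD[OF conv]) auto
        moreover have "(1/2) *\<^sub>R (2 * a) + (1/2) *\<^sub>R (2 * (v - a)) = v" for a :: real
          by (simp add: field_simps)
        ultimately show "v \<in> D (y $ j)" by metis
      qed
      then have "ball ((A *v x) $ j) (e / 2) \<subseteq> interior (D (y $ j))"
        by (simp add: interior_maximal)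
      moreover have "s \<in> ball ((A *v x) $ j) (e / 2)"
        using s by (simp add: dist_real_def abs_minus_commute)
      ultimately show ?thesis by blast
    qed
    then show ?thesis using e by (intro exI[of _ "e / 2"]) auto
  qed
  then obtain e where e: "\<And>j. e j > 0"
    "\<And>j x s. x \<in> vecs C \<Longrightarrow> \<bar>s - (A *v x) $ j\<bar> < e j \<Longrightarrow> s \<in> interior (D (y $ j))"
    by metis
  have "Min (range e) > 0" "\<And>j. Min (range e) \<le> e j" using e(1) by auto
  then show ?thesis using e(2) by (intro exI[of _ "Min (range e)"]) (meson order_less_le_trans)
qed

lemma gradient_bound_exists:
  assumes "bdd_above ((\<lambda>w. norm (grad (G g y) w)) ` (*v) A ` vecs C)"
  shows "\<exists>Lt\<ge>L. gradient_bound g y A C Lt"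
proof -
  obtain B where B: "\<And>x. x \<in> vecs C \<Longrightarrow> norm (grad (G g y) (A *v x)) \<le> B"
    using assms unfolding bdd_above_def by auto
  obtain e where e: "e > 0"
    "\<And>x j s. x \<in> vecs C \<Longrightarrow> \<bar>s - (A *v x) $ j\<bar> < e \<Longrightarrow> s \<in> interior (D (y $ j))"
    using uniform_interior by auto
  \<comment> \<open>Large enough that gradient steps, of length at most \<open>B / Lt\<close>, stay
    within the uniform radius \<open>e\<close>.\<close>
  define Lt where "Lt = max L ((B + 1) / e)"
  have "B + 1 \<le> e * Lt"
    using e(1) by (simp add: Lt_def max_def field_simps)
  then have "gradient_bound g y A C Lt"
    unfolding gradient_bound_def
    using B by (auto intro!: norm_grad_G_le[where e = e] e(2) simp: Lt_def) (smt (verit) B)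
  then show ?thesis by (intro exI[of _ Lt]) (simp add: Lt_def)
qed

end

section \<open>Restricted strong convexity and the oracle\<close>

lemma supp_scaleR: "t \<noteq> 0 \<Longrightarrow> supp (t *\<^sub>R x) = supp x"
  by (auto simp: supp_def)

lemma l0_minus_commute: "l0 (x - z) = l0 (z - x)"
proof -
  have "supp (x - z) = supp (z - x)" by (auto simp: supp_def)
  then show ?thesis by (simp add: l0_def)
qed

lemma supp_diff_subset: "supp (x - z) \<subseteq> supp x \<union> supp z"
  by (auto simp: supp_def)

lemma supp_add_scaleR_subset: "supp (x + h *\<^sub>R (z - x)) \<subseteq> supp x \<union> supp z"
  by (auto simp: supp_def)

lemma l0_mono: "supp x \<subseteq> S \<Longrightarrow> l0 x \<le> card S"
  unfolding l0_def by (rule card_mono) auto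

lemma matrix_mult_zero_pad: "A *v zero_pad S u = (\<Sum>i\<in>S. u i *\<^sub>R column i A)"
proof -
  have "A *v zero_pad S u = (\<Sum>i\<in>UNIV. zero_pad S u $ i *\<^sub>R column i A)"
    by (simp add: matrix_mult_sum scalar_mult_eq_scaleR)
  also have "\<dots> = (\<Sum>i\<in>S. u i *\<^sub>R column i A)"
    by (rule sum.mono_neutral_cong_right) (auto simp: zero_pad_def)
  finally show ?thesis .
qed

lemma Fsub_eq: "Fsub g y A S u = F g y A (zero_pad S u)"
  by (simp add: Fsub_def F_def matrix_mult_zero_pad)

lemma zero_pad_restrict: "supp x \<subseteq> S \<Longrightarrow> zero_pad S (restrict (($) x) S) = x"
  by (auto simp: zero_pad_def supp_def vec_eq_iff)

text \<open>The image of \<open>S \<rightarrow>\<^sub>E C\<close> under \<open>zero_pad\<close> when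
  \<open>0 \<in> C\<close>. It lets the restricted problem be studied with the gradient of
  \<open>F\<close> on the full space.\<close>

definition sparse_vecs :: "real set \<Rightarrow> 'n set \<Rightarrow> (real^'n) set" where
  "sparse_vecs C S = {x \<in> vecs C. supp x \<subseteq> S}"

lemma zero_pad_sparse: "0 \<in> C \<Longrightarrow> u \<in> S \<rightarrow>\<^sub>E C \<Longrightarrow> zero_pad S u \<in> sparse_vecs C S"
  by (auto simp: sparse_vecs_def vecs_def supp_def zero_pad_def)

lemma closed_sparse_vecs:
  assumes "closed C"
  shows "closed (sparse_vecs C S)"
proof -
  have eq: "sparse_vecs C S = (\<Inter>i. (\<lambda>x. x $ i) -` (if i \<in> S then C else C \<inter> {0}))"
    by (force simp: sparse_vecs_def vecs_def supp_def split: if_splits)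
  show ?thesis
    unfolding eq using assms by (intro closed_INT ballI closed_vimage_vec_nth) auto
qed

locale brsc = data_fidelity C A y D g L
  for C :: "real set" and A :: "real^'n^'m" and y D g L +
  fixes \<gamma> CK :: real and K :: nat and X :: "(real^'n) set"
  assumes gamma: "0 < \<gamma>" and CK: "0 < CK"
    and X: "X \<subseteq> vecs C"
    and BRSC: "BRSC (F g y A) C X K CK \<gamma>"
begin

text \<open>Every point of the segment other than \<open>x\<close> differs from \<open>x\<close> on
  the same coordinates as \<open>z\<close> does. Hence (BRSC) based at \<open>x\<close> applies all
  along it; the moving point is only required to lie in \<open>vecs C\<close>.\<close>

lemma F_growth:
  assumes x: "x \<in> X" and z: "z \<in> vecs C" and l0: "l0 (z - x) \<le> K"
  shows "F g y A x + grad (F g y A) x \<bullet> (z - x) + CK * \<gamma> / 2 * (norm (z - x))\<^sup>2 \<le> F g y A z"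
proof (cases "z = x")
  case False
  define d where "d = z - x"
  have d: "d \<noteq> 0" "l0 (x - z) \<le> K" using False l0 by (auto simp: d_def l0_minus_commute)
  have xC: "x \<in> vecs C" using x X by auto
  define \<phi> where "\<phi> t = F g y A (x + t *\<^sub>R d) - t * (grad (F g y A) x \<bullet> d)
    - CK * \<gamma> / 2 * t\<^sup>2 * (norm d)\<^sup>2" for t
  have "\<phi> 0 \<le> \<phi> 1"
  proof (rule DERIV_nonneg_imp_nondecreasing[where f = \<phi>])
    fix t :: real assume t: "0 \<le> t" "t \<le> 1"
    have xt: "x + t *\<^sub>R d \<in> vecs C"
      using vecs_convex_comb[OF C xC z t] by (simp add: d_def)
    have "((\<lambda>t. x + t *\<^sub>R d) has_derivative (\<lambda>h. h *\<^sub>R d)) (at t)"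
      by (auto intro!: derivative_eq_intros)
    from has_derivative_compose[OF this F_gderiv'[OF xt, unfolded gderiv_def]]
    have "((\<lambda>t. F g y A (x + t *\<^sub>R d)) has_real_derivative grad (F g y A) (x + t *\<^sub>R d) \<bullet> d) (at t)"
      by (simp add: has_field_derivative_def inner_commute mult_commute_abs)
    then have "(\<phi> has_real_derivative grad (F g y A) (x + t *\<^sub>R d) \<bullet> d - grad (F g y A) x \<bullet> d
        - CK * \<gamma> * t * (norm d)\<^sup>2) (at t)"
      unfolding \<phi>_def by (auto intro!: derivative_eq_intros)
    moreover have "0 \<le> grad (F g y A) (x + t *\<^sub>R d) \<bullet> d - grad (F g y A) x \<bullet> d
        - CK * \<gamma> * t * (norm d)\<^sup>2"
    proof (cases "t = 0")
      case False
      then have t0: "t > 0" using t by simp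
      have diff: "x - (x + t *\<^sub>R d) = t *\<^sub>R (x - z)" by (simp add: d_def algebra_simps)
      have "l0 (x - (x + t *\<^sub>R d)) \<le> K"
        using d t0 unfolding diff l0_def by (simp add: supp_scaleR)
      moreover have "x + t *\<^sub>R d \<noteq> x" using t0 d by simp
      ultimately have "CK * \<gamma> * (norm (x - (x + t *\<^sub>R d)))\<^sup>2
          \<le> (grad (F g y A) x - grad (F g y A) (x + t *\<^sub>R d)) \<bullet> (x - (x + t *\<^sub>R d))"
        using BRSC x xt unfolding BRSC_def by blast
      then have "t * (CK * \<gamma> * t * (norm d)\<^sup>2)
          \<le> t * (grad (F g y A) (x + t *\<^sub>R d) \<bullet> d - grad (F g y A) x \<bullet> d)"
        by (simp add: inner_diff_left power_mult_distrib power2_eq_square algebra_simps)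
      then have "CK * \<gamma> * t * (norm d)\<^sup>2
          \<le> grad (F g y A) (x + t *\<^sub>R d) \<bullet> d - grad (F g y A) x \<bullet> d"
        using t0 by (simp only: mult_le_cancel_left_pos)
      then show ?thesis by simp
    qed simp
    ultimately show "\<exists>y. (\<phi> has_real_derivative y) (at t) \<and> 0 \<le> y" by blast
  qed simp
  then show ?thesis by (simp add: \<phi>_def d_def)
qed simp

text \<open>Compares (BRSC) with the Lipschitz bound along one coordinate direction. The increment
  is positive, so the half line is not left. Its purpose is to exclude the wrong sign inside the
  square of \<open>Lambda_up\<close>.\<close>

lemma brsc_const_le_column:
  assumes "xs \<in> X" "1 \<le> K"
  shows "CK * \<gamma> \<le> L * (norm (column i A))\<^sup>2"
proof -
  define z where "z = xs + axis i 1"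
  have xs: "xs \<in> vecs C" using assms X by auto
  then have z: "z \<in> vecs C"
    using C by (auto simp: z_def vecs_def axis_def)
  have "supp (xs - z) = {i}" by (auto simp: z_def supp_def axis_def)
  then have "l0 (xs - z) \<le> K" using assms by (simp add: l0_def)
  moreover have "z \<noteq> xs" by (simp add: z_def)
  ultimately have "CK * \<gamma> * (norm (xs - z))\<^sup>2
      \<le> (grad (F g y A) xs - grad (F g y A) z) \<bullet> (xs - z)"
    using BRSC assms z unfolding BRSC_def by blast
  then have "CK * \<gamma> \<le> grad (F g y A) z $ i - grad (F g y A) xs $ i"
    by (simp add: z_def inner_axis)
  also have "\<dots> = column i A \<bullet> (grad (G g y) (A *v z) - grad (G g y) (A *v xs))"
    by (simp add: grad_F_nth[OF z] grad_F_nth[OF xs] inner_diff_right)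
  also have "\<dots> = (\<Sum>j\<in>UNIV. A $ j $ i * (deriv (g (y $ j)) ((A *v z) $ j)
      - deriv (g (y $ j)) ((A *v xs) $ j)))"
    unfolding inner_vec_def by (simp add: grad_G_nth[OF z] grad_G_nth[OF xs] column_def)
  also have "\<dots> \<le> (\<Sum>j\<in>UNIV. L * (A $ j $ i)\<^sup>2)"
  proof (rule sum_mono)
    fix j
    have diff: "(A *v z) $ j - (A *v xs) $ j = A $ j $ i"
      by (simp add: z_def matrix_vector_right_distrib matrix_vector_mult_basis column_def)
    have "A $ j $ i * (deriv (g (y $ j)) ((A *v z) $ j) - deriv (g (y $ j)) ((A *v xs) $ j))
        \<le> \<bar>A $ j $ i\<bar> * \<bar>deriv (g (y $ j)) ((A *v z) $ j) - deriv (g (y $ j)) ((A *v xs) $ j)\<bar>"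
      by (metis abs_ge_self abs_mult)
    also have "\<dots> \<le> \<bar>A $ j $ i\<bar> * (L * \<bar>A $ j $ i\<bar>)"
      using deriv_g_lipschitz[OF range_interior[OF z, of j] range_interior[OF xs]]
      unfolding diff by (intro mult_left_mono) auto
    finally show "A $ j $ i * (deriv (g (y $ j)) ((A *v z) $ j) - deriv (g (y $ j)) ((A *v xs) $ j))
        \<le> L * (A $ j $ i)\<^sup>2" by (simp add: power2_eq_square algebra_simps)
  qed
  also have "\<dots> = L * (norm (column i A))\<^sup>2"
    unfolding power2_norm_eq_inner inner_vec_def
    by (simp add: column_def power2_eq_square sum_distrib_left)
  finally show ?thesis .
qed

lemma sparse_minimizer_exists:
  assumes xs: "xs \<in> X" "supp xs \<subseteq> S" and "card S \<le> K"
  shows "\<exists>x\<in>sparse_vecs C S. \<forall>z\<in>sparse_vecs C S. F g y A x \<le> F g y A z"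
proof -
  \<comment> \<open>Beyond this radius the quadratic term of the growth outweighs the linear one, so
    \<open>F\<close> is at least \<open>F xs\<close>.\<close>
  define R where "R = 2 * norm (grad (F g y A) xs) / (CK * \<gamma>)"
  define T where "T = sparse_vecs C S \<inter> cball xs R"
  have R: "0 \<le> R" using CK gamma by (simp add: R_def)
  have xsT: "xs \<in> sparse_vecs C S" using xs X by (auto simp: sparse_vecs_def)
  have "closed C" using C by auto
  then have "compact T"
    unfolding T_def by (intro closed_Int_compact closed_sparse_vecs) auto
  moreover have "xs \<in> T" using xsT R by (simp add: T_def)
  moreover have "continuous_on T (F g y A)"
    by (rule continuous_on_subset[OF F_continuous_on]) (auto simp: T_def sparse_vecs_def)
  ultimately obtain x where x: "x \<in> T" "\<And>z. z \<in> T \<Longrightarrow> F g y A x \<le> F g y A z"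
    using continuous_attains_inf[of T "F g y A"] by blast
  have "F g y A x \<le> F g y A z" if z: "z \<in> sparse_vecs C S" for z
  proof (cases "z \<in> T")
    case False
    define n where "n = norm (z - xs)"
    have "supp (z - xs) \<subseteq> S"
      using z xs supp_diff_subset[of z xs] by (auto simp: sparse_vecs_def)
    then have "l0 (z - xs) \<le> K"
      using l0_mono assms(3) order_trans by blast
    then have growth: "F g y A xs + grad (F g y A) xs \<bullet> (z - xs) + CK * \<gamma> / 2 * n\<^sup>2 \<le> F g y A z"
      using F_growth[OF xs(1)] z by (simp add: sparse_vecs_def n_def)
    have "R < n" using z False by (simp add: T_def n_def dist_norm norm_minus_commute)
    then have "2 * norm (grad (F g y A) xs) < CK * \<gamma> * n"
      using CK gamma by (simp add: R_def field_simps)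
    then have "2 * norm (grad (F g y A) xs) * n \<le> CK * \<gamma> * n * n"
      by (intro mult_right_mono) (auto simp: n_def)
    moreover have "\<bar>grad (F g y A) xs \<bullet> (z - xs)\<bar> \<le> norm (grad (F g y A) xs) * n"
      unfolding n_def by (rule Cauchy_Schwarz_ineq2)
    ultimately have "F g y A xs \<le> F g y A z"
      using growth by (simp add: power2_eq_square)
    then show ?thesis using x(2)[OF \<open>xs \<in> T\<close>] by simp
  qed (use x in auto)
  then show ?thesis using x(1) by (auto simp: T_def)
qed

end

section \<open>The oracle solution and its optimality conditions\<close>

locale brsc_oracle = brsc C A y D g L \<gamma> CK K X
  for C :: "real set" and A :: "real^'n^'m" and y D g L \<gamma> CK K X +
  fixes xs x_or :: "real^'n"
  assumes x_or: "x_or = oracle_solution g y A C (supp xs)"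
    and xs_X: "xs \<in> X" and x_or_X: "x_or \<in> X"
    and K: "2 * l0 xs \<le> K" "K \<le> CARD('n)"
begin

abbreviation "S \<equiv> supp xs"

text \<open>\<open>arg_min_on\<close> is a choice and says something only once a minimiser exists.
  One is found among sparse vectors and restricted to \<open>S\<close>.\<close>

lemma oracle_coeffs_minimal:
  "oracle_coeffs g y A C S \<in> S \<rightarrow>\<^sub>E C"
  "u \<in> S \<rightarrow>\<^sub>E C \<Longrightarrow> Fsub g y A S (oracle_coeffs g y A C S) \<le> Fsub g y A S u"
proof -
  have C0: "0 \<in> C" using C by auto
  have "card S \<le> K" using K by (simp add: l0_def)
  then obtain x where x: "x \<in> sparse_vecs C S" "\<And>z. z \<in> sparse_vecs C S \<Longrightarrow> F g y A x \<le> F g y A z"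
    using sparse_minimizer_exists[OF xs_X order_refl] by blast
  have mem: "restrict (($) x) S \<in> S \<rightarrow>\<^sub>E C"
    using x(1) by (auto simp: sparse_vecs_def vecs_def)
  have pad: "zero_pad S (restrict (($) x) S) = x"
    using x(1) by (intro zero_pad_restrict) (simp add: sparse_vecs_def)
  have "is_arg_min (Fsub g y A S) (\<lambda>u. u \<in> S \<rightarrow>\<^sub>E C) (restrict (($) x) S)"
    unfolding is_arg_min_linorder Fsub_eq pad using mem x(2)[OF zero_pad_sparse[OF C0]] by blast
  then have "is_arg_min (Fsub g y A S) (\<lambda>u. u \<in> S \<rightarrow>\<^sub>E C) (oracle_coeffs g y A C S)"
    unfolding oracle_coeffs_def arg_min_on_def arg_min_def
    by (rule someI[where P = "is_arg_min (Fsub g y A S) (\<lambda>u. u \<in> S \<rightarrow>\<^sub>E C)"])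
  then show "oracle_coeffs g y A C S \<in> S \<rightarrow>\<^sub>E C"
    "u \<in> S \<rightarrow>\<^sub>E C \<Longrightarrow> Fsub g y A S (oracle_coeffs g y A C S) \<le> Fsub g y A S u"
    unfolding is_arg_min_linorder by blast+
qed

lemma oracle_sparse: "x_or \<in> sparse_vecs C S"
proof -
  have "0 \<in> C" using C by auto
  from zero_pad_sparse[OF this oracle_coeffs_minimal(1)] show ?thesis
    by (simp add: x_or oracle_solution_def)
qed

lemma oracle_mem: "x_or \<in> vecs C" and oracle_supp: "supp x_or \<subseteq> S"
  using oracle_sparse by (auto simp: sparse_vecs_def)

lemma oracle_minimal:
  assumes "z \<in> sparse_vecs C S"
  shows "F g y A x_or \<le> F g y A z"
proof -
  have "restrict (($) z) S \<in> S \<rightarrow>\<^sub>E C"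
    using assms by (auto simp: sparse_vecs_def vecs_def)
  moreover have "zero_pad S (restrict (($) z) S) = z"
    using assms by (intro zero_pad_restrict) (simp add: sparse_vecs_def)
  ultimately show ?thesis
    using oracle_coeffs_minimal(2)[of "restrict (($) z) S"]
    by (simp add: x_or oracle_solution_def Fsub_eq)
qed

lemma xs_sparse: "xs \<in> sparse_vecs C S"
  using xs_X X by (auto simp: sparse_vecs_def)

text \<open>The first-order condition on a convex set: a negative slope towards \<open>z\<close>
  would give smaller values at feasible points close to \<open>x_or\<close>.\<close>

lemma oracle_variational:
  assumes z: "z \<in> sparse_vecs C S"
  shows "0 \<le> grad (F g y A) x_or \<bullet> (z - x_or)"
proof (rule ccontr)
  define d where "d = z - x_or"
  assume "\<not> ?thesis"
  then have neg: "grad (F g y A) x_or \<bullet> d < 0" by (simp add: d_def)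
  have "((\<lambda>t. x_or + t *\<^sub>R d) has_derivative (\<lambda>h. h *\<^sub>R d)) (at 0)"
    by (auto intro!: derivative_eq_intros)
  from has_derivative_compose[OF this, of "F g y A" "\<lambda>h. h \<bullet> grad (F g y A) x_or"]
    F_gderiv'[OF oracle_mem, unfolded gderiv_def]
  have "((\<lambda>t. F g y A (x_or + t *\<^sub>R d)) has_real_derivative grad (F g y A) x_or \<bullet> d) (at 0)"
    by (simp add: has_field_derivative_def inner_commute mult_commute_abs)
  from DERIV_neg_dec_right[OF this neg]
  obtain e where e: "e > 0" "\<And>h. 0 < h \<Longrightarrow> h < e \<Longrightarrow> F g y A (x_or + h *\<^sub>R d) < F g y A x_or"
    by auto
  \<comment> \<open>The cap at 1 keeps the point on the segment from \<open>x_or\<close> to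
    \<open>z\<close>, hence feasible.\<close>
  define h where "h = min (e / 2) 1"
  have h: "0 < h" "h < e" "h \<le> 1" using e by (auto simp: h_def min_def)
  have "x_or + h *\<^sub>R d \<in> vecs C"
    using vecs_convex_comb[OF C oracle_mem, of z h] z h by (simp add: sparse_vecs_def d_def)
  moreover have "supp (x_or + h *\<^sub>R d) \<subseteq> S"
  proof -
    have "supp z \<subseteq> S" using z by (simp add: sparse_vecs_def)
    then show ?thesis
      using oracle_supp supp_add_scaleR_subset[of x_or h z] unfolding d_def by blast
  qed
  ultimately show False
    using oracle_minimal[of "x_or + h *\<^sub>R d"] e(2)[OF h(1,2)] by (simp add: sparse_vecs_def)
qed

text \<open>The variational inequality is tested by doubling and by deleting coordinate
  \<open>i\<close>. Both moves are feasible on the half line as well, and they have opposite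
  signs.\<close>

lemma oracle_stationary:
  assumes "x_or $ i \<noteq> 0"
  shows "grad (F g y A) x_or $ i = 0"
proof -
  have i: "i \<in> S" using assms oracle_supp by (auto simp: supp_def)
  have "0 \<le> s * grad (F g y A) x_or $ i" if s: "s = x_or $ i \<or> s = - (x_or $ i)" for s
  proof -
    have nth: "(x_or + s *\<^sub>R axis i 1) $ k = (if k = i then x_or $ i + s else x_or $ k)" for k
      by (simp add: axis_def)
    have "x_or $ i \<in> C" using oracle_mem by (simp add: vecs_def)
    then have "x_or $ i + s \<in> C" using C s by (elim disjE) simp_all
    then have "x_or + s *\<^sub>R axis i 1 \<in> vecs C"
      using oracle_mem unfolding vecs_def mem_Collect_eq nth by simp
    moreover have "supp (x_or + s *\<^sub>R axis i 1) \<subseteq> S"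
    proof
      fix k assume "k \<in> supp (x_or + s *\<^sub>R axis i 1)"
      then have "k = i \<or> k \<in> supp x_or"
        unfolding supp_def mem_Collect_eq nth by (simp split: if_splits)
      then show "k \<in> S" using i oracle_supp by blast
    qed
    ultimately have "x_or + s *\<^sub>R axis i 1 \<in> sparse_vecs C S"
      by (simp add: sparse_vecs_def)
    from oracle_variational[OF this] show ?thesis by (simp add: inner_axis)
  qed
  from this[of "x_or $ i"] this[of "- (x_or $ i)"] show ?thesis using assms by simp
qed

text \<open>Growth is based at the oracle and tested at \<open>xs\<close>. The linear term is
  nonnegative but need not vanish: at this stage the oracle may be zero at some index of
  \<open>S\<close>, where on the half line its gradient can be positive.\<close>

lemma oracle_near_truth: "(norm (xs - x_or))\<^sup>2 \<le> 2 * F g y A xs / (\<gamma> * CK)"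
proof -
  have "supp (xs - x_or) \<subseteq> S"
    using supp_diff_subset[of xs x_or] oracle_supp by auto
  then have "l0 (xs - x_or) \<le> K"
    using l0_mono[of "xs - x_or" S] K by (simp add: l0_def)
  then have "F g y A x_or + grad (F g y A) x_or \<bullet> (xs - x_or) + CK * \<gamma> / 2 * (norm (xs - x_or))\<^sup>2
      \<le> F g y A xs"
    using F_growth[OF x_or_X] xs_X X by auto
  moreover have "0 \<le> F g y A x_or" using F_nonneg[OF oracle_mem] .
  ultimately have "CK * \<gamma> / 2 * (norm (xs - x_or))\<^sup>2 \<le> F g y A xs"
    using oracle_variational[OF xs_sparse] by simp
  then show ?thesis using CK gamma by (simp add: field_simps)
qed

end

section \<open>Separation and global minimality\<close>

lemma continuous_on_upd: "continuous_on T (upd x i)"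
proof -
  have "continuous_on T (\<lambda>t. if k = i then t else x $ k)" for k
    by (cases "k = i") (auto intro: continuous_intros)
  then show ?thesis unfolding upd_def[abs_def] by (rule continuous_on_vec_lambda)
qed

lemma grad_Psi: "grad (Psi \<gamma>) x = \<gamma> *\<^sub>R x"
proof (rule grad_eq)
  have "((\<lambda>x. \<gamma> / 2 * (x \<bullet> x)) has_derivative (\<lambda>h. h \<bullet> (\<gamma> *\<^sub>R x))) (at x)"
    by (auto intro!: derivative_eq_intros simp: inner_commute)
  then show "GDERIV (Psi \<gamma>) x :> \<gamma> *\<^sub>R x"
    by (simp add: gderiv_def Psi_def[abs_def] power2_norm_eq_inner)
qed

section \<open>Descent from the relaxation to the original objective by concavity\<close>

context data_fidelity
begin

lemma JPsi_upd_continuous_on: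
  assumes "0 < \<gamma>" "0 < lam0" "x \<in> vecs C" "T \<subseteq> C"
  shows "continuous_on T (\<lambda>t. JPsi g y A \<gamma> lam0 (upd x i t))"
proof -
  have "upd x i ` T \<subseteq> vecs C" using assms by (auto simp: vecs_def upd_nth)
  then have "continuous_on T (\<lambda>t. F g y A (upd x i t))"
    by (rule continuous_on_compose2[OF F_continuous_on continuous_on_upd])
  moreover have "continuous_on T (\<lambda>t. beta \<gamma> lam0 (upd x i t $ k))" for k
    unfolding beta_eq[OF assms(1,2)]
    by (intro continuous_intros continuous_on_component continuous_on_upd)
  ultimately show ?thesis
    unfolding JPsi_def F_def by (intro continuous_intros) auto
qed

lemma JPsi_decrease_coordinate:
  assumes gl: "0 < \<gamma>" "0 < lam0" and cc: "CC g y A C \<gamma> lam0" and x: "x \<in> vecs C"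
    and i: "x $ i \<noteq> 0" "\<bar>x $ i\<bar> < alpha \<gamma> lam0"
  shows "\<exists>t\<in>C. (t = 0 \<or> alpha \<gamma> lam0 \<le> \<bar>t\<bar>) \<and> JPsi g y A \<gamma> lam0 (upd x i t) < JPsi g y A \<gamma> lam0 x"
proof -
  let ?\<alpha> = "alpha \<gamma> lam0" and ?f = "\<lambda>t. JPsi g y A \<gamma> lam0 (upd x i t)"
  have C0: "0 \<in> C" "?\<alpha> \<in> C" "{0..?\<alpha>} \<subseteq> C" "0 \<le> ?\<alpha>" using C i by auto
  show ?thesis
  proof (cases "0 < x $ i")
    case True
    have "?f 0 < ?f (x $ i) \<or> ?f ?\<alpha> < ?f (x $ i)"
      using cc x True i JPsi_upd_continuous_on[OF gl x C0(3)]
      by (intro strictly_concave_interior_gt[where f = ?f and a = 0 and b = ?\<alpha> and t = "x $ i"])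
        (auto simp: CC_def)
    then show ?thesis
    proof
      assume "?f 0 < ?f (x $ i)"
      then show ?thesis using C0 by (intro bexI[of _ 0]) (auto simp: upd_same)
    next
      assume "?f ?\<alpha> < ?f (x $ i)"
      then show ?thesis using C0 by (intro bexI[of _ ?\<alpha>]) (auto simp: upd_same)
    qed
  next
    case False
    then have neg: "x $ i < 0" using i by simp
    \<comment> \<open>Negative coordinates occur only on the full line, which is where
      \<open>CC\<close> gives concavity on (-\<alpha>, 0).\<close>
    have CU: "C = UNIV"
    proof (rule ccontr)
      assume "C \<noteq> UNIV"
      then have "0 \<le> x $ i" using C x by (auto simp: vecs_def)
      with neg show False by simp
    qed
    have "?f (- ?\<alpha>) < ?f (x $ i) \<or> ?f 0 < ?f (x $ i)"
      using cc x neg i CU JPsi_upd_continuous_on[OF gl x, of "{- ?\<alpha>..0}" i]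
      by (intro strictly_concave_interior_gt[where f = ?f and a = "- ?\<alpha>" and b = 0 and t = "x $ i"])
        (auto simp: CC_def)
    then show ?thesis
    proof
      assume "?f (- ?\<alpha>) < ?f (x $ i)"
      then show ?thesis using CU C0 by (intro bexI[of _ "- ?\<alpha>"]) (auto simp: upd_same)
    next
      assume "?f 0 < ?f (x $ i)"
      then show ?thesis using C0 by (intro bexI[of _ 0]) (auto simp: upd_same)
    qed
  qed
qed

text \<open>Induction on the number of coordinates strictly between 0 and \<alpha> in modulus; each
  move settles one and leaves the others alone. Keeping the decrease strict unless
  \<open>z = x\<close> is what yields uniqueness later.\<close>

lemma JPsi_decrease:
  assumes gl: "0 < \<gamma>" "0 < lam0" and cc: "CC g y A C \<gamma> lam0" and x: "x \<in> vecs C"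
  shows "\<exists>z\<in>vecs C. (\<forall>i. z $ i = 0 \<or> alpha \<gamma> lam0 \<le> \<bar>z $ i\<bar>) \<and>
    (z = x \<or> JPsi g y A \<gamma> lam0 z < JPsi g y A \<gamma> lam0 x)"
  using x
proof (induction "card {i. \<not> (x $ i = 0 \<or> alpha \<gamma> lam0 \<le> \<bar>x $ i\<bar>)}" arbitrary: x rule: less_induct)
  case less
  let ?B = "\<lambda>x. {i. \<not> (x $ i = 0 \<or> alpha \<gamma> lam0 \<le> \<bar>x $ i\<bar>)}"
  show ?case
  proof (cases "?B x = {}")
    case True
    then show ?thesis using less.prems by blast
  next
    case False
    then obtain i where i: "i \<in> ?B x" by auto
    then obtain t where t: "t \<in> C" "t = 0 \<or> alpha \<gamma> lam0 \<le> \<bar>t\<bar>"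
      "JPsi g y A \<gamma> lam0 (upd x i t) < JPsi g y A \<gamma> lam0 x"
      using JPsi_decrease_coordinate[OF gl cc less.prems, of i] by auto
    have "?B (upd x i t) \<subset> ?B x" using i t by (auto simp: upd_nth)
    then have "card (?B (upd x i t)) < card (?B x)" by (intro psubset_card_mono) auto
    moreover have "upd x i t \<in> vecs C" using t less.prems by (auto simp: vecs_def upd_nth)
    ultimately obtain z where "z \<in> vecs C" "\<forall>i. z $ i = 0 \<or> alpha \<gamma> lam0 \<le> \<bar>z $ i\<bar>"
      "z = upd x i t \<or> JPsi g y A \<gamma> lam0 z < JPsi g y A \<gamma> lam0 (upd x i t)"
      using less.hyps by blast
    with t(3) show ?thesis by (intro bexI[of _ z]) auto
  qed
qed

end

text \<open>The interval for \<open>lam0\<close> acts only through these margins, which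
  \<open>separated_oracleI\<close> derives from it. The factor \<open>min CK 1\<close> fits both the
  separation and the growth inequalities.\<close>

locale separated_oracle = brsc_oracle C A y D g L \<gamma> CK K X xs x_or
  for C :: "real set" and A :: "real^'n^'m" and y D g L \<gamma> CK K X xs x_or +
  fixes lam0 :: real
  assumes lam0: "0 < lam0"
    and off_support: "i \<notin> supp xs \<Longrightarrow> \<bar>grad (F g y A) x_or $ i\<bar> < \<gamma> * alpha \<gamma> lam0 * min CK 1"
    and on_support: "i \<in> supp xs \<Longrightarrow> alpha \<gamma> lam0 < \<bar>x_or $ i\<bar> * min CK 1"
    and level: "F g y A xs < lam0 * (1 + real K - 2 * real (l0 xs))"
begin

lemma alpha_pos: "0 < alpha \<gamma> lam0"
  using gamma lam0 by (simp add: alpha_def)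

lemma oracle_large: "i \<in> S \<Longrightarrow> alpha \<gamma> lam0 < \<bar>x_or $ i\<bar>"
  using on_support[of i] mult_left_mono[of "min CK 1" 1 "\<bar>x_or $ i\<bar>"] by simp

lemma oracle_supp_eq: "supp x_or = S"
  using oracle_supp oracle_large alpha_pos by (fastforce simp: supp_def)

lemma oracle_zero: "i \<notin> S \<Longrightarrow> x_or $ i = 0"
  using oracle_supp_eq by (auto simp: supp_def)

lemma oracle_grad_zero: "i \<in> S \<Longrightarrow> grad (F g y A) x_or $ i = 0"
  using oracle_stationary oracle_supp_eq by (auto simp: supp_def)

text \<open>For the dual vectors \<open>z\<close> and \<open>z_or\<close>, (BRSC) bounds
  \<open>(z - z_or) \<bullet> d\<close> above by \<gamma> (1 - CK) |d|^2. The separation lemmas,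
  summed over the coordinates where \<open>d\<close> is nonzero, give the strict reverse
  inequality.\<close>

lemma critical_point_far:
  assumes crit: "critical_point g y A C \<gamma> lam0 x" and ne: "x \<noteq> x_or"
  shows "K < l0 (x - x_or)"
proof (rule ccontr)
  assume "\<not> ?thesis"
  then have "l0 (x_or - x) \<le> K" by (simp add: l0_minus_commute)
  have x: "x \<in> vecs C" using crit by (simp add: critical_point_def)
  define d where "d = x - x_or"
  define z where "z = \<gamma> *\<^sub>R x - grad (F g y A) x"
  define z_or where "z_or = \<gamma> *\<^sub>R x_or - grad (F g y A) x_or"
  have "CK * \<gamma> * (norm (x_or - x))\<^sup>2 \<le> (grad (F g y A) x_or - grad (F g y A) x) \<bullet> (x_or - x)"
    using BRSC x_or_X x ne \<open>l0 (x_or - x) \<le> K\<close> unfolding BRSC_def by blast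
  then have "CK * \<gamma> * (norm d)\<^sup>2 \<le> (grad (F g y A) x - grad (F g y A) x_or) \<bullet> d"
    by (simp add: d_def norm_minus_commute inner_diff_left inner_diff_right)
  moreover have "(z - z_or) \<bullet> d = \<gamma> * (norm d)\<^sup>2 - (grad (F g y A) x - grad (F g y A) x_or) \<bullet> d"
    by (simp add: z_def z_or_def d_def power2_norm_eq_inner inner_diff_left inner_diff_right algebra_simps)
  ultimately have upper: "(z - z_or) \<bullet> d \<le> \<gamma> * (1 - CK) * (norm d)\<^sup>2"
    by (simp add: algebra_simps)
  have coord: "\<gamma> * (1 - CK) * (d $ i)\<^sup>2 < (z - z_or) $ i * d $ i" if di: "d $ i \<noteq> 0" for i
  proof -
    have "x $ i \<in> C" using x by (simp add: vecs_def)
    moreover have "z $ i \<in> subdiff_h C \<gamma> lam0 (x $ i)"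
      using crit by (simp add: critical_point_def z_def grad_Psi grad_F[OF x])
    ultimately have h: "\<bar>x $ i\<bar> \<le> alpha \<gamma> lam0 \<Longrightarrow> \<bar>z $ i\<bar> \<le> \<gamma> * alpha \<gamma> lam0"
      "\<bar>x $ i\<bar> \<le> alpha \<gamma> lam0 \<Longrightarrow> z $ i * x $ i = \<gamma> * alpha \<gamma> lam0 * \<bar>x $ i\<bar>"
      "alpha \<gamma> lam0 < \<bar>x $ i\<bar> \<Longrightarrow> z $ i = \<gamma> * x $ i"
      using subdiff_h_bounds[OF C _ _ gamma lam0] by blast+
    show ?thesis
    proof (cases "i \<in> S")
      case True
      then have "z_or $ i = \<gamma> * x_or $ i" using oracle_grad_zero by (simp add: z_or_def)
      then show ?thesis
        using separation_on_support[OF gamma CK on_support[OF True] _ h] di by (simp add: d_def)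
    next
      case False
      have "\<bar>z_or $ i\<bar> < \<gamma> * alpha \<gamma> lam0 * min CK 1"
        using off_support[OF False] oracle_zero[OF False] by (simp add: z_or_def)
      from separation_off_support[OF gamma CK this _ h(2,3)] show ?thesis
        using di oracle_zero[OF False] by (simp add: d_def)
    qed
  qed
  obtain i where i: "d $ i \<noteq> 0" using ne by (auto simp: d_def vec_eq_iff)
  have "(\<Sum>i\<in>UNIV. \<gamma> * (1 - CK) * (d $ i)\<^sup>2) < (\<Sum>i\<in>UNIV. (z - z_or) $ i * d $ i)"
  proof (rule sum_strict_mono_ex1)
    show "\<forall>i\<in>UNIV. \<gamma> * (1 - CK) * (d $ i)\<^sup>2 \<le> (z - z_or) $ i * d $ i"
      using coord by (metis less_imp_le mult_zero_right order_refl power_zero_numeral)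
    show "\<exists>i\<in>UNIV. \<gamma> * (1 - CK) * (d $ i)\<^sup>2 < (z - z_or) $ i * d $ i"
      using coord[OF i] by blast
  qed simp
  then have "\<gamma> * (1 - CK) * (norm d)\<^sup>2 < (z - z_or) \<bullet> d"
    unfolding power2_norm_eq_inner inner_vec_def by (simp add: sum_distrib_left power2_eq_square)
  with upper show False by simp
qed

lemma JPsi_near:
  assumes x: "x \<in> vecs C" and ne: "x \<noteq> x_or" and near: "l0 (x - x_or) \<le> K"
  shows "JPsi g y A \<gamma> lam0 x_or < JPsi g y A \<gamma> lam0 x"
proof -
  define d where "d = x - x_or"
  \<comment> \<open>The coordinate shares of the lower bound that growth at the oracle gives for the
    difference of the two objective values.\<close>
  define T where "T i = beta \<gamma> lam0 (x $ i) - beta \<gamma> lam0 (x_or $ i)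
    + grad (F g y A) x_or $ i * d $ i + CK * \<gamma> / 2 * (d $ i)\<^sup>2" for i
  have pos: "0 < T i" if di: "d $ i \<noteq> 0" for i
  proof (cases "i \<in> S")
    case True
    then show ?thesis
      using beta_growth_on_support[OF gamma lam0 CK on_support[OF True], of "x $ i"] di
        oracle_grad_zero[OF True] by (simp add: T_def d_def)
  next
    case False
    have "\<bar>- (grad (F g y A) x_or $ i)\<bar> < \<gamma> * alpha \<gamma> lam0 * min CK 1"
      using off_support[OF False] by simp
    from beta_growth_off_support[OF gamma lam0 CK this, of "x $ i"] show ?thesis
      using di oracle_zero[OF False] beta_eq_l0[OF gamma lam0, of 0] by (simp add: T_def d_def)
  qed
  have zero: "T i = 0" if "d $ i = 0" for i
    using that by (simp add: T_def d_def)
  obtain i where i: "d $ i \<noteq> 0" using ne by (auto simp: d_def vec_eq_iff)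
  have "0 < (\<Sum>i\<in>UNIV. T i)"
    by (rule sum_pos2[of _ i]) (use pos zero i in \<open>auto intro: less_imp_le simp: order_le_less\<close>)
  also have "(\<Sum>i\<in>UNIV. T i) = (\<Sum>i\<in>UNIV. beta \<gamma> lam0 (x $ i)) - (\<Sum>i\<in>UNIV. beta \<gamma> lam0 (x_or $ i))
      + grad (F g y A) x_or \<bullet> d + CK * \<gamma> / 2 * (norm d)\<^sup>2"
    unfolding T_def power2_norm_eq_inner inner_vec_def
    by (simp add: sum.distrib sum_subtractf sum_distrib_left power2_eq_square)
  finally show ?thesis
    using F_growth[OF x_or_X x near] by (simp add: JPsi_def F_def d_def)
qed

lemma JPsi_oracle: "JPsi g y A \<gamma> lam0 x_or = J0 g y A lam0 x_or"
  using oracle_large oracle_zero by (intro JPsi_eq_J0[OF gamma lam0]) (meson less_imp_le)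

lemma J0_minimal:
  assumes x: "x \<in> vecs C" and ne: "x \<noteq> x_or"
  shows "J0 g y A lam0 x_or < J0 g y A lam0 x"
proof (cases "l0 (x - x_or) \<le> K")
  case True
  from JPsi_near[OF x ne this] show ?thesis
    using JPsi_le_J0[OF gamma lam0, of g y A x] JPsi_oracle by simp
next
  case False
  have "l0 (x - x_or) \<le> card (supp x \<union> S)"
    using supp_diff_subset[of x x_or] oracle_supp by (intro l0_mono) auto
  also have "\<dots> \<le> l0 x + l0 xs" unfolding l0_def by (rule card_Un_le)
  \<comment> \<open>The distance is an integer above \<open>K\<close>, hence at least
    \<open>K + 1\<close>: this is the 1 in \<open>level\<close>.\<close>
  finally have "1 + real K - real (l0 xs) \<le> real (l0 x)" using False by simp
  then have "lam0 * (1 + real K - real (l0 xs)) \<le> lam0 * real (l0 x)"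
    using lam0 by (intro mult_left_mono) auto
  moreover have "F g y A x_or \<le> F g y A xs" by (rule oracle_minimal[OF xs_sparse])
  moreover have "l0 x_or = l0 xs" using oracle_supp_eq by (simp add: l0_def)
  ultimately show ?thesis
    using level F_nonneg[OF x] by (simp add: J0_def algebra_simps)
qed

lemma JPsi_minimal:
  assumes cc: "CC g y A C \<gamma> lam0" and x: "x \<in> vecs C" and ne: "x \<noteq> x_or"
  shows "JPsi g y A \<gamma> lam0 x_or < JPsi g y A \<gamma> lam0 x"
proof -
  obtain z where z: "z \<in> vecs C" "\<And>i. z $ i = 0 \<or> alpha \<gamma> lam0 \<le> \<bar>z $ i\<bar>"
    "z = x \<or> JPsi g y A \<gamma> lam0 z < JPsi g y A \<gamma> lam0 x"
    using JPsi_decrease[OF gamma lam0 cc x] by blast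
  have "JPsi g y A \<gamma> lam0 z = J0 g y A lam0 z" by (rule JPsi_eq_J0[OF gamma lam0 z(2)])
  \<comment> \<open>If \<open>z\<close> is the oracle, then \<open>z \<noteq> x\<close> and the
    descent was strict; otherwise \<open>J0_minimal\<close> supplies the strictness.\<close>
  then show ?thesis
    using z(3) J0_minimal[OF z(1)] ne JPsi_oracle by (cases "z = x_or") auto
qed

end

section \<open>From the interval for the penalty weight to the margins\<close>

context brsc_oracle
begin

text \<open>The two entries of the maximum in \<open>Lambda_low\<close> give the gradient margin off
  the support and \<open>level\<close>. \<open>Lambda_up\<close>, combined with the distance from
  the oracle to the truth, gives the coordinate margin on the support.\<close>

lemma separated_oracleI:
  assumes lam0: "0 < lam0" and Lt: "L \<le> Lt" "gradient_bound g y A C Lt"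
    and low: "Lambda_low g y A \<gamma> CK K Lt xs < lam0"
    and up: "ereal lam0 < Lambda_up g y A \<gamma> CK xs"
  shows "separated_oracle C A y D g L \<gamma> CK K X xs x_or lam0"
proof unfold_locales
  define m where "m = min CK 1"
  define M where "M = (MAX i\<in>- S. (norm (column i A))\<^sup>2)"
  define f where "f = F g y A xs"
  have m: "0 < m" "m \<le> 1" "m\<^sup>2 \<le> CK" "m\<^sup>2 = min (CK\<^sup>2) 1"
    using min_one_bounds[OF CK] by (auto simp: m_def)
  have xsC: "xs \<in> vecs C" using xs_X X by auto
  have f0: "0 \<le> f" using F_nonneg[OF xsC] by (simp add: f_def)
  have Lt0: "0 < Lt" using L Lt by simp
  have "f * (Lt / (\<gamma> * m\<^sup>2) * M) \<le> Lambda_low g y A \<gamma> CK K Lt xs"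
    "f * (1 / (1 + real K - 2 * real (l0 xs))) \<le> Lambda_low g y A \<gamma> CK K Lt xs"
    unfolding Lambda_low_def m(4) M_def f_def using f0[unfolded f_def]
    by (intro mult_left_mono max.cobounded1 max.cobounded2; simp)+
  then have low1: "f * (Lt / (\<gamma> * m\<^sup>2) * M) < lam0"
    and low2: "f * (1 / (1 + real K - 2 * real (l0 xs))) < lam0"
    using low by auto
  have column_bound: "f * Lt * (norm (column i A))\<^sup>2 < lam0 * \<gamma> * m\<^sup>2" if "i \<notin> S" for i
  proof -
    have "(norm (column i A))\<^sup>2 \<le> M" unfolding M_def using that by (intro Max_ge) auto
    then have "f * Lt * (norm (column i A))\<^sup>2 \<le> f * Lt * M"
      using f0 Lt0 by (intro mult_left_mono) auto
    also have "\<dots> < lam0 * \<gamma> * m\<^sup>2" using low1 gamma m(1) by (simp add: field_simps)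
    finally show ?thesis .
  qed
  have alpha2: "(alpha \<gamma> lam0)\<^sup>2 = 2 * lam0 / \<gamma>" and alpha0: "0 < alpha \<gamma> lam0"
    using gamma lam0 by (auto simp: alpha_def)
  show "0 < lam0" by fact
  show "F g y A xs < lam0 * (1 + real K - 2 * real (l0 xs))"
  proof -
    have "0 < 1 + real K - 2 * real (l0 xs)" using K by linarith
    then show ?thesis using low2 by (simp add: f_def field_simps)
  qed
  show "\<bar>grad (F g y A) x_or $ i\<bar> < \<gamma> * alpha \<gamma> lam0 * min CK 1" if "i \<notin> S" for i
  proof -
    have "\<bar>grad (F g y A) x_or $ i\<bar> \<le> norm (column i A) * norm (grad (G g y) (A *v x_or))"
      unfolding grad_F_nth[OF oracle_mem] by (rule Cauchy_Schwarz_ineq2)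
    also have "\<dots> \<le> norm (column i A) * sqrt (2 * Lt * f)"
    proof (rule mult_left_mono)
      have "norm (grad (G g y) (A *v x_or)) \<le> sqrt (2 * Lt * F g y A x_or)"
        using Lt(2) oracle_mem by (auto simp: gradient_bound_def F_def)
      also have "\<dots> \<le> sqrt (2 * Lt * f)"
        using oracle_minimal[OF xs_sparse] Lt0 by (simp add: f_def)
      finally show "norm (grad (G g y) (A *v x_or)) \<le> sqrt (2 * Lt * f)" .
    qed simp
    also have "\<dots> < \<gamma> * alpha \<gamma> lam0 * min CK 1"
    \<comment> \<open>After squaring, \<alpha>^2 = 2 \<lambda>0 / \<gamma> turns the claim into
      \<open>column_bound\<close>.\<close>
    proof (rule power2_less_imp_less)
      have "(norm (column i A) * sqrt (2 * Lt * f))\<^sup>2 = 2 * (f * Lt * (norm (column i A))\<^sup>2)"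
        using Lt0 f0 by (simp add: power_mult_distrib)
      also have "\<dots> < 2 * (lam0 * \<gamma> * m\<^sup>2)" using column_bound[OF that] by simp
      also have "\<dots> = (\<gamma> * alpha \<gamma> lam0 * min CK 1)\<^sup>2"
        using gamma unfolding power_mult_distrib alpha2 m_def[symmetric]
        by (simp add: power2_eq_square field_simps)
      finally show "(norm (column i A) * sqrt (2 * Lt * f))\<^sup>2 < (\<gamma> * alpha \<gamma> lam0 * min CK 1)\<^sup>2" .
    qed (use gamma alpha0 CK in auto)
    finally show ?thesis .
  qed
  show "alpha \<gamma> lam0 < \<bar>x_or $ i\<bar> * min CK 1" if i: "i \<in> S" for i
  proof -
    define \<mu> where "\<mu> = (MIN i\<in>S. \<bar>xs $ i\<bar>)"
    define r where "r = sqrt (2 * f / (\<gamma> * CK))"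
    have r2: "r\<^sup>2 = 2 * f / (\<gamma> * CK)" and r0: "0 \<le> r" using f0 gamma CK by (auto simp: r_def)
    have "\<mu> \<in> (\<lambda>i. \<bar>xs $ i\<bar>) ` S" unfolding \<mu>_def using i by (intro Min_in) auto
    then have \<mu>: "\<mu> \<le> \<bar>xs $ i\<bar>" "0 \<le> \<mu>" using i by (auto simp: \<mu>_def)
    have up': "lam0 < \<gamma> / 2 * m\<^sup>2 * (\<mu> - r)\<^sup>2"
      using up i unfolding Lambda_up_def m(4) \<mu>_def r_def f_def by (auto split: if_splits)
    have "0 < card S" using i by (simp add: card_gt_0_iff) blast
    \<comment> \<open>A nonempty support with 2 k* \<le> K \<le> N leaves an index outside it, the
      direction needed for \<open>brsc_const_le_column\<close>.\<close>
    then have "card S < CARD('n)" "1 \<le> K" using K unfolding l0_def by linarith+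
    then have "S \<noteq> UNIV" by auto
    then obtain l where "l \<notin> S" by auto
    text \<open>Since \<open>\<Lambda>\<close>-bar is the square of a difference, the hypothesis alone does not exclude
      \<open>\<mu> < r\<close>.  Restricted strong convexity along \<open>e\<^sub>l\<close> for \<open>l\<close> off the support does.\<close>
    have "CK * \<gamma> \<le> Lt * (norm (column l A))\<^sup>2"
      using brsc_const_le_column[OF xs_X \<open>1 \<le> K\<close>, of l] Lt(1)
      by (meson mult_right_mono order_trans zero_le_power2)
    then have "f * (CK * \<gamma>) \<le> f * (Lt * (norm (column l A))\<^sup>2)"
      using f0 by (rule mult_left_mono)
    also have "\<dots> < lam0 * \<gamma> * m\<^sup>2" using column_bound[OF \<open>l \<notin> S\<close>] by (simp add: mult.assoc)
    finally have fCK: "f * CK < lam0 * m\<^sup>2" using gamma by (simp add: field_simps)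
    have "r < \<mu>"
    proof (rule ccontr)
      assume "\<not> r < \<mu>"
      \<comment> \<open>For 0 \<le> \<mu> \<le> r the upper bound would give \<lambda>0 CK < m^2 f,
        while \<open>fCK\<close> and m^2 \<le> CK give m^2 f \<le> CK f < \<lambda>0 m^2 \<le>
        \<lambda>0 CK.\<close>
      then have "(\<mu> - r)\<^sup>2 \<le> r\<^sup>2" using \<mu> by (intro power2_le_iff_abs_le[THEN iffD2]) auto
      then have "\<gamma> / 2 * m\<^sup>2 * (\<mu> - r)\<^sup>2 \<le> \<gamma> / 2 * m\<^sup>2 * r\<^sup>2"
        using gamma by (intro mult_left_mono) auto
      with up' have "lam0 < \<gamma> / 2 * m\<^sup>2 * r\<^sup>2" by simp
      then have "lam0 * CK < m\<^sup>2 * f"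
        using gamma CK unfolding r2 by (simp add: field_simps)
      also have "m\<^sup>2 * f \<le> CK * f" using m(3) f0 by (rule mult_right_mono)
      also have "\<dots> < lam0 * m\<^sup>2" using fCK by (simp add: mult.commute)
      also have "\<dots> \<le> lam0 * CK" using m(3) lam0 by simp
      finally show False by simp
    qed
    have "(alpha \<gamma> lam0)\<^sup>2 < (m * (\<mu> - r))\<^sup>2"
      using up' gamma unfolding alpha2 power_mult_distrib by (simp add: pos_divide_less_eq mult_ac)
    then have "alpha \<gamma> lam0 < m * (\<mu> - r)"
      by (rule power2_less_imp_less) (use m(1) \<open>r < \<mu>\<close> in simp)
    also have "\<dots> \<le> m * \<bar>x_or $ i\<bar>"
    proof (rule mult_left_mono)
      have "norm (xs - x_or) \<le> r"
        unfolding r_def by (rule real_le_rsqrt) (use oracle_near_truth in \<open>simp add: f_def\<close>)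
      moreover have "\<bar>xs $ i - x_or $ i\<bar> \<le> norm (xs - x_or)"
        using component_le_norm_cart[of "xs - x_or" i] by simp
      ultimately show "\<mu> - r \<le> \<bar>x_or $ i\<bar>" using \<mu>(1) by linarith
    qed (use m in simp)
    finally show ?thesis by (simp add: m_def mult.commute)
  qed
qed

text \<open>Padding with zeros preserves the distance, so \<open>oracle_near_truth\<close> carries
  over to coefficient vectors.\<close>

lemma oracle_in_ball:
  "oracle_coeffs g y A C S \<in> feasible_ball C S (restrict (($) xs) S)
     (sqrt (2 * Fsub g y A S (restrict (($) xs) S) / (\<gamma> * CK)))"
proof -
  let ?u = "oracle_coeffs g y A C S"
  have "L2_set (\<lambda>i. ?u i - restrict (($) xs) S i) S = norm (x_or - xs)"
    unfolding norm_vec_def L2_set_def x_or oracle_solution_def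
    by (intro arg_cong[where f = sqrt] sum.mono_neutral_cong_left) (auto simp: zero_pad_def supp_def)
  also have "\<dots> \<le> sqrt (2 * F g y A xs / (\<gamma> * CK))"
    using oracle_near_truth by (intro real_le_rsqrt) (simp add: norm_minus_commute)
  also have "F g y A xs = Fsub g y A S (restrict (($) xs) S)"
    by (simp add: Fsub_eq zero_pad_restrict)
  finally show ?thesis
    using oracle_coeffs_minimal(1) by (simp add: feasible_ball_def)
qed

end

theorem corollary6p2:
  fixes C :: "real set" and A :: "real^'n^'m" and Y :: "real set" and y :: "real^'m"
    and D :: "real \<Rightarrow> real set" and g :: "real \<Rightarrow> real \<Rightarrow> real"
    and L \<gamma> lam0 CK :: real and K :: nat
    and xs x_or :: "real^'n" and u_or :: "'n \<Rightarrow> real" and X :: "(real^'n) set"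
  assumes C: "C = UNIV \<or> C = {0..}"
    and y: "\<And>j. y $ j \<in> Y"
    and lam0_pos: "lam0 > 0"
    and L: "L > 0"
    and data_term: "\<And>j. scalar_data_term L (D (y $ j)) (g (y $ j))"
    and constrained: "domG D y \<noteq> UNIV \<Longrightarrow>
        closure ((*v) A ` vecs C) \<subseteq> interior (domG D y) \<and>
        bdd_above ((\<lambda>w. norm (grad (G g y) w)) ` (*v) A ` vecs C)"
    and feasible: "vecs C \<subseteq> interior (domF D y A)"
    and gamma: "\<gamma> > 0" "\<gamma> > curvature_bound D g y A C"
    and CC: "CC g y A C \<gamma> lam0"
    and truth: "xs \<in> vecs C"
    and full_rank: "dim ((\<lambda>i. column i A) ` supp xs) = l0 xs"
    and u_or: "u_or = oracle_coeffs g y A C (supp xs)"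
    and x_or: "x_or = oracle_solution g y A C (supp xs)"
    and K: "2 * l0 xs \<le> K" "K \<le> CARD('n)"
    and X: "X \<subseteq> vecs C" "compact X" "x_or \<in> X" "xs \<in> X"
    and CK: "CK > 0"
    and BRSC: "BRSC (F g y A) C X K CK \<gamma>"
  shows "u_or \<in> feasible_ball C (supp xs) (restrict (($) xs) (supp xs))
             (sqrt (2 * Fsub g y A (supp xs) (restrict (($) xs) (supp xs)) / (\<gamma> * CK)))
     \<and> (\<exists>Lt\<ge>L. gradient_bound g y A C Lt)
     \<and> (domG D y = UNIV \<longrightarrow> gradient_bound g y A C L)
     \<and> (\<forall>Lt\<ge>L. gradient_bound g y A C Lt \<longrightarrow>
           Lambda_low g y A \<gamma> CK K Lt xs < lam0 \<longrightarrow> ereal lam0 < Lambda_up g y A \<gamma> CK xs \<longrightarrow>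
             global_minimizers (JPsi g y A \<gamma> lam0) (vecs C) = {x_or}
           \<and> global_minimizers (J0 g y A lam0) (vecs C) = {x_or}
           \<and> supp x_or = supp xs
           \<and> (\<forall>x'. critical_point g y A C \<gamma> lam0 x' \<and> x' \<noteq> x_or \<longrightarrow> l0 (x' - x_or) > K))"
proof -
  have range_interior: "(A *v x) $ j \<in> interior (D (y $ j))" if "x \<in> vecs C" for x j
  proof (cases "domG D y = UNIV")
    case True
    then show ?thesis by (simp add: domG_UNIV_iff)
  next
    case False
    have "A *v x \<in> closure ((*v) A ` vecs C)"
      by (rule subsetD[OF closure_subset]) (simp add: that)
    then have "A *v x \<in> interior (domG D y)" using constrained[OF False] by (meson subsetD)
    then show ?thesis by (rule interior_domG_nth)
  qed
  interpret ground_truth: brsc_oracle C A y D g L \<gamma> CK K X xs x_or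
  proof (intro brsc_oracle.intro brsc.intro)
    show "data_fidelity C A y D g L"
      by (rule data_fidelity.intro[OF C L data_term range_interior])
    show "brsc_axioms C A y g \<gamma> CK K X"
      by (rule brsc_axioms.intro[OF gamma(1) CK X(1) BRSC])
    show "brsc_oracle_axioms C A y g K X xs x_or"
      by (rule brsc_oracle_axioms.intro[OF x_or X(4,3) K])
  qed
  have "\<exists>Lt\<ge>L. gradient_bound g y A C Lt"
  proof (cases "domG D y = UNIV")
    case True
    then show ?thesis using ground_truth.gradient_bound_unconstrained by blast
  next
    case False
    then show ?thesis using ground_truth.gradient_bound_exists constrained by simp
  qed
  moreover have "global_minimizers (JPsi g y A \<gamma> lam0) (vecs C) = {x_or}
      \<and> global_minimizers (J0 g y A lam0) (vecs C) = {x_or}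
      \<and> supp x_or = supp xs
      \<and> (\<forall>x'. critical_point g y A C \<gamma> lam0 x' \<and> x' \<noteq> x_or \<longrightarrow> l0 (x' - x_or) > K)"
    if "L \<le> Lt" "gradient_bound g y A C Lt" "Lambda_low g y A \<gamma> CK K Lt xs < lam0"
      "ereal lam0 < Lambda_up g y A \<gamma> CK xs" for Lt
  proof -
    interpret separated: separated_oracle C A y D g L \<gamma> CK K X xs x_or lam0
      by (rule ground_truth.separated_oracleI[OF lam0_pos that])
    have "global_minimizers (JPsi g y A \<gamma> lam0) (vecs C) = {x_or}"
      by (rule global_minimizers_eq_singleton[where f = "JPsi g y A \<gamma> lam0",
          OF ground_truth.oracle_mem separated.JPsi_minimal[OF CC]])
    moreover have "global_minimizers (J0 g y A lam0) (vecs C) = {x_or}"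
      by (rule global_minimizers_eq_singleton[where f = "J0 g y A lam0",
          OF ground_truth.oracle_mem separated.J0_minimal])
    ultimately show ?thesis
      using separated.oracle_supp_eq separated.critical_point_far by blast
  qed
  ultimately show ?thesis
    using ground_truth.oracle_in_ball ground_truth.gradient_bound_unconstrained unfolding u_or by blast
qed

end
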